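(* For $n\ge 5$ let $L_n:=\sum_{T\in\mathcal{T}(P_n^3)}|\mathcal{L}(T)|$ be the total number of leaves over all spanning trees of the third power $P_n^3$ of the path on $n$ vertices. Then, as formal power series, $$\sum_{m=0}^{\infty} L_{m+5}\,t^m=\frac{2(16t^{10}-154t^9+403t^8-340t^7+963t^6-768t^5+1109t^4-788t^3+509t^2-470t+96)}{(t-1)^2(t^4-4t^3-t^2-4t+1)^2}.$$
   Context: All graphs are finite and simple. $P_n$ is the path graph on $n$ vertices. For a graph $G$ and $k\ge1$, the $k$-th power $G^k$ has $V(G^k)=V(G)$, and $uv$ is an edge iff the distance between $u$ and $v$ in $G$ is at least $1$ and at most $k$. $\mathcal{T}(G)$ is the set of labeled spanning trees of $G$ (isomorphic trees with different labels are different). $\mathcal{L}(T)$ is the set of leaves (vertices of degree exactly $1$ in $T$) of $T$. The family is $\mathcal{P}_k=\{P_n^k : k<\operatorname{diam} P_n\}=\{P_n^k : n\ge k+2\}$, here with $k=3$; the sequence is indexed so that the constant term of the generating function corresponds to the smallest member $n=k+2$. *)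

theory Defs
  imports "HOL-Computational_Algebra.Formal_Power_Series" "Graph_Theory.Graph_Theory"
begin

text \<open>
  A finite simple graph is a finite symmetric loop-free pair digraph (locale \<^locale>\<open>pair_graph\<close>):
  the edge \<open>uv\<close> is the pair of arcs \<open>(u, v)\<close>, \<open>(v, u)\<close>. In particular a labeled simple graph is
  represented by exactly one value of type \<^typ>\<open>'a pair_pre_digraph\<close>.
\<close>

definition path_graph :: "nat \<Rightarrow> nat pair_pre_digraph" where
  "path_graph n =
    \<lparr> pverts = {1..n},
      parcs = {(i, j). i \<in> {1..n} \<and> j \<in> {1..n} \<and> (j = Suc i \<or> i = Suc j)} \<rparr>"

text \<open>The distance is infinite for vertices in different components.\<close>

definition graph_dist :: "'a pair_pre_digraph \<Rightarrow> 'a \<Rightarrow> 'a \<Rightarrow> ereal" where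
  "graph_dist G u v = wf_digraph.\<mu> (with_proj G) (\<lambda>_. 1) u v"

definition graph_power :: "'a pair_pre_digraph \<Rightarrow> nat \<Rightarrow> 'a pair_pre_digraph" where
  "graph_power G k =
    \<lparr> pverts = pverts G,
      parcs = {(u, v). u \<in> pverts G \<and> v \<in> pverts G \<and>
                       1 \<le> graph_dist G u v \<and> graph_dist G u v \<le> ereal (real k)} \<rparr>"

text \<open>
  \<^const>\<open>Digraph_Component.forest\<close> forbids all directed cycles, including the closed walk
  \<open>u, v, u\<close> along the two arcs of a single edge, so no symmetric digraph with an edge is a
  \<^const>\<open>Digraph_Component.tree\<close> in the library's sense. The cycles of a simple graph are the
  directed cycles of length at least 3.
\<close>

definition graph_tree :: "'a pair_pre_digraph \<Rightarrow> bool" where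
  "graph_tree T \<longleftrightarrow>
    pair_graph T \<and> Digraph_Component.connected (with_proj T) \<and>
    \<not> (\<exists>p. pre_digraph.cycle (with_proj T) p \<and> 3 \<le> length p)"

definition spanning_trees :: "'a pair_pre_digraph \<Rightarrow> 'a pair_pre_digraph set" where
  "spanning_trees G = {T. graph_tree T \<and> spanning (with_proj T) (with_proj G)}"

text \<open>In a symmetric digraph the out-degree is the degree of the underlying simple graph.\<close>

definition leaves :: "'a pair_pre_digraph \<Rightarrow> 'a set" where
  "leaves T = {v \<in> pverts T. out_degree (with_proj T) v = 1}"

definition total_leaves :: "'a pair_pre_digraph \<Rightarrow> nat" where
  "total_leaves G = (\<Sum>T\<in>spanning_trees G. card (leaves T))"

lemma pair_graph_path_graph: "pair_graph (path_graph n)"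
proof unfold_locales
  show "finite (parcs (path_graph n))"
    by (rule finite_subset[of _ "{1..n} \<times> {1..n}"]) (auto simp: path_graph_def)
  have "sym (parcs (path_graph n))"
    by (rule symI) (auto simp: path_graph_def)
  then show "symmetric (with_proj (path_graph n))"
    by (simp add: symmetric_def)
qed (auto simp: path_graph_def)

lemma finite_spanning_trees:
  assumes "finite (parcs G)"
  shows "finite (spanning_trees G)"
proof -
  have "spanning_trees G \<subseteq> (\<lambda>A. \<lparr> pverts = pverts G, parcs = A \<rparr>) ` Pow (parcs G)"
  proof
    fix T assume "T \<in> spanning_trees G"
    then have "pverts T = pverts G" "parcs T \<subseteq> parcs G"
      by (auto simp: spanning_trees_def spanning_def subgraph_def)
    then show "T \<in> (\<lambda>A. \<lparr> pverts = pverts G, parcs = A \<rparr>) ` Pow (parcs G)"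
      by (intro image_eqI[of _ _ "parcs T"]) auto
  qed
  then show ?thesis by (rule finite_subset) (use assms in auto)
qed

corollary finite_spanning_trees_power:
  "finite (spanning_trees (graph_power (path_graph n) k))"
  by (rule finite_spanning_trees, rule finite_subset[of _ "{1..n} \<times> {1..n}"])
     (auto simp: graph_power_def path_graph_def)

end

theory Submission
  imports Defs
begin

text \<open>
  A leaf \<open>v\<close> of a spanning tree \<open>T\<close> of a graph \<open>G\<close> hangs on one of the neighbours of \<open>v\<close>, and the rest
  of \<open>T\<close> is a spanning tree of \<open>G - v\<close>; conversely a spanning tree of \<open>G - v\<close> and a neighbour of \<open>v\<close>
  give such a \<open>T\<close>. Hence the number of leaves over all spanning trees is the sum over \<open>v\<close> of
  \<open>deg v\<close> times the number of spanning trees of \<open>G - v\<close> (\<open>sum_leaves\<close>).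

  For the cube of a path, the spanning trees of \<open>G - v\<close> are counted by scanning the vertices from left
  to right. A partial tree is a forest each of whose components still meets the last three
  vertices, since only these have edges to later vertices. All that matters for the continuation is
  the partition that the forest induces on these three vertices, one of five. So the census of the
  forests by partition is a vector of length 5, and adding a vertex adjacent to all three is a
  linear map \<open>A\<close> (\<open>full_step\<close>). Deleting a vertex \<open>v\<close> does not destroy this picture: the last three
  remaining vertices still separate the past from the future, only that each of the next three
  vertices is adjacent to the last two of them, not to all three, which gives a second linear map \<open>B\<close>
  (\<open>short_step\<close>). With \<open>t\<close> the census of a triangle (\<open>triangle_census\<close>), the number of
  spanning trees of \<open>G - v\<close> is therefore the entry of \<open>A\<^sup>l B\<^sup>3 A\<^sup>k t\<close> at the one-block partition
  (\<open>tree_count_delete_inner\<close>), where \<open>k\<close> and \<open>l\<close> measure the distances of \<open>v\<close> from the ends,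
  with fewer factors \<open>B\<close> when \<open>v\<close> is one of the three first or last vertices.

  The generating series \<open>U\<close> of the vectors \<open>A\<^sup>m t\<close> and \<open>W\<close> of the weighted sums of the vectors
  \<open>A\<^sup>l B\<^sup>3 A\<^sup>k t\<close> satisfy \<open>U = t + X A U\<close> and \<open>W = w + X (A W + 6 B\<^sup>3 U)\<close>. By Cramer's rule, with
  \<open>D = - det (1 - X A)\<close>, the entries of \<open>D U\<close> and \<open>D\<^sup>2 W\<close> are polynomials. Such a linear system has at
  most one solution (\<open>full_step_fps_unique\<close>), so that explicit polynomials are proved right by
  substituting them into it. The series of the theorem is a combination of entries of \<open>U\<close> and \<open>W\<close>
  (\<open>leaf_total_series\<close>).

  Edge sets of graphs are symmetric relations, and such a relation is a forest iff each of its edges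
  is a bridge. This form of acyclicity, unlike the absence of cycles, is immediate to track when a
  vertex is added; \<open>acyclic_iff_all_bridges\<close> relates the two.
\<close>

section \<open>Adding a vertex to a forest\<close>

definition all_bridges :: "('a \<times> 'a) set \<Rightarrow> bool" where
  "all_bridges E \<longleftrightarrow> (\<forall>(u, v) \<in> E. (u, v) \<notin> (E - {(u, v), (v, u)})\<^sup>*)"

definition add_vertex :: "'a \<Rightarrow> 'a set \<Rightarrow> ('a \<times> 'a) set \<Rightarrow> ('a \<times> 'a) set" where
  "add_vertex w S E = E \<union> {w} \<times> S \<union> S \<times> {w}"

lemma sym_add_vertex: "sym E \<Longrightarrow> sym (add_vertex w S E)"
  by (auto simp: add_vertex_def sym_def)

lemma sym_rtrancl_iff: "sym E \<Longrightarrow> (x, y) \<in> E\<^sup>* \<longleftrightarrow> (y, x) \<in> E\<^sup>*"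
  by (meson sym_rtrancl symD)

text \<open>
  A walk through the new vertex \<open>w\<close> enters and leaves it through neighbours in \<open>S\<close>; between its
  visits to \<open>w\<close> it stays in \<open>E\<close>. So it suffices to record the first and the last of these neighbours.
\<close>

lemma reach_add_vertex:
  assumes w: "w \<notin> Field E" and E: "sym E" and "x \<noteq> w"
  shows "(x, y) \<in> (add_vertex w S E)\<^sup>* \<longleftrightarrow>
    (if y = w then \<exists>s\<in>S. (x, s) \<in> E\<^sup>*
     else (x, y) \<in> E\<^sup>* \<or> (\<exists>s\<in>S. \<exists>s'\<in>S. (x, s) \<in> E\<^sup>* \<and> (s', y) \<in> E\<^sup>*))" (is "?L \<longleftrightarrow> ?R y")
proof
  assume ?L
  then show "?R y"
  proof (induction rule: rtrancl_induct)
    case base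
    then show ?case using \<open>x \<noteq> w\<close> by simp
  next
    case (step y z)
    then consider "(y, z) \<in> E" "y \<noteq> w" "z \<noteq> w" | "y = w" "z \<in> S" | "y \<in> S" "z = w"
      using w by (auto simp: add_vertex_def Field_def)
    then show ?case
      using step.IH by cases (auto 4 4 split: if_splits intro: rtrancl_into_rtrancl rtrancl_trans)
  qed
next
  have mono: "(u, v) \<in> E\<^sup>* \<Longrightarrow> (u, v) \<in> (add_vertex w S E)\<^sup>*" for u v
    by (rule rtrancl_mono[THEN subsetD, rotated]) (auto simp: add_vertex_def)
  have new: "s \<in> S \<Longrightarrow> (s, w) \<in> (add_vertex w S E)\<^sup>* \<and> (w, s) \<in> (add_vertex w S E)\<^sup>*" for s
    by (auto simp: add_vertex_def)
  assume "?R y"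
  then show ?L
    using mono new by (auto split: if_splits) (meson rtrancl_trans)+
qed

text \<open>
  The new vertex closes a cycle exactly if two of its neighbours were already connected. The old
  edges are the harder case: a detour around an old edge \<open>uv\<close> through \<open>w\<close> uses two neighbours of \<open>w\<close>
  that are connected in \<open>E\<close> via \<open>uv\<close>; these coincide, so that the visit to \<open>w\<close> can be cut out.
\<close>

lemma all_bridges_add_vertex:
  assumes w: "w \<notin> Field E" "w \<notin> S" and E: "sym E"
  shows "all_bridges (add_vertex w S E) \<longleftrightarrow>
    all_bridges E \<and> (\<forall>s\<in>S. \<forall>s'\<in>S. (s, s') \<in> E\<^sup>* \<longrightarrow> s = s')" (is "?L \<longleftrightarrow> ?R")
proof
  assume L: ?L
  have "all_bridges E"
    unfolding all_bridges_def
  proof safe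
    fix u v assume uv: "(u, v) \<in> E" "(u, v) \<in> (E - {(u, v), (v, u)})\<^sup>*"
    then have "(u, v) \<in> (add_vertex w S E - {(u, v), (v, u)})\<^sup>*"
      by (elim rtrancl_mono[THEN subsetD, rotated]) (auto simp: add_vertex_def)
    with L uv(1) show False by (auto simp: all_bridges_def add_vertex_def)
  qed
  moreover have "s = s'" if s: "s \<in> S" "s' \<in> S" "(s, s') \<in> E\<^sup>*" for s s'
  proof (rule ccontr)
    assume ne: "s \<noteq> s'"
    let ?F = "add_vertex w S E - {(s, w), (w, s)}"
    have "(s, s') \<in> ?F\<^sup>*"
      using s(3) by (rule rtrancl_mono[THEN subsetD, rotated])
        (use w in \<open>auto simp: add_vertex_def Field_def\<close>)
    moreover have "(s', w) \<in> ?F" using ne s w by (auto simp: add_vertex_def)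
    ultimately have "(s, w) \<in> ?F\<^sup>*" by (rule rtrancl_into_rtrancl)
    with L s(1) show False by (auto simp: all_bridges_def add_vertex_def)
  qed
  ultimately show ?R by blast
next
  assume R: ?R
  have new: "(s, w) \<notin> (add_vertex w S E - {(s, w), (w, s)})\<^sup>*" if s: "s \<in> S" for s
  proof
    have "add_vertex w S E - {(s, w), (w, s)} = add_vertex w (S - {s}) E"
      using w s by (auto simp: add_vertex_def Field_def)
    moreover assume "(s, w) \<in> (add_vertex w S E - {(s, w), (w, s)})\<^sup>*"
    ultimately have "(s, w) \<in> (add_vertex w (S - {s}) E)\<^sup>*" by simp
    then show False using s w R by (subst (asm) reach_add_vertex[OF w(1) E]) auto
  qed
  have old: "(u, v) \<notin> (add_vertex w S E - {(u, v), (v, u)})\<^sup>*" if uv: "(u, v) \<in> E" for u v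
  proof
    let ?F = "E - {(u, v), (v, u)}"
    have bridge: "(u, v) \<notin> ?F\<^sup>*" using R uv by (auto simp: all_bridges_def)
    have ne: "u \<noteq> w" "v \<noteq> w" using w uv by (auto simp: Field_def)
    have sym: "sym ?F" using E by (auto simp: sym_def)
    have "add_vertex w S E - {(u, v), (v, u)} = add_vertex w S ?F"
      using w uv ne by (auto simp: add_vertex_def)
    moreover assume "(u, v) \<in> (add_vertex w S E - {(u, v), (v, u)})\<^sup>*"
    ultimately have "(u, v) \<in> (add_vertex w S ?F)\<^sup>*" by simp
    moreover have "w \<notin> Field ?F" using w by (auto simp: Field_def)
    ultimately obtain s s' where s: "s \<in> S" "s' \<in> S" "(u, s) \<in> ?F\<^sup>*" "(s', v) \<in> ?F\<^sup>*"
      using ne bridge by (subst (asm) reach_add_vertex[OF _ sym]) auto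
    have sub: "?F\<^sup>* \<subseteq> E\<^sup>*" by (rule rtrancl_mono) auto
    have "(s, u) \<in> E\<^sup>*" "(v, s') \<in> E\<^sup>*"
      using s sub sym_rtrancl_iff[OF E] by blast+
    with uv have "(s, s') \<in> E\<^sup>*" by (meson rtrancl_into_rtrancl rtrancl_trans)
    with R s have "s = s'" by blast
    with s bridge show False by (meson rtrancl_trans)
  qed
  show ?L
    unfolding all_bridges_def
  proof safe
    fix u v assume "(u, v) \<in> add_vertex w S E" and c: "(u, v) \<in> (add_vertex w S E - {(u, v), (v, u)})\<^sup>*"
    then consider "(u, v) \<in> E" | "u = w" "v \<in> S" | "u \<in> S" "v = w" by (auto simp: add_vertex_def)
    then show False
    proof cases
      case 2
      have "sym (add_vertex w S E - {(u, v), (v, u)})" using sym_add_vertex[OF E, of w S] by (auto simp: sym_def)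
      then have "(v, u) \<in> (add_vertex w S E - {(v, u), (u, v)})\<^sup>*"
        using c sym_rtrancl_iff by (metis insert_commute)
      with new 2 show False by blast
    qed (use c old new in auto)
  qed
qed

lemma add_vertex_delete:
  assumes "sym E" "(w, w) \<notin> E"
  shows "E = add_vertex w (E `` {w}) (E \<inter> (- {w}) \<times> (- {w}))"
  using assms by (auto simp: add_vertex_def sym_def)

lemma add_vertex_inject:
  assumes "w \<notin> Field E" "w \<notin> S" "w \<notin> Field E'" "w \<notin> S'" "add_vertex w S E = add_vertex w S' E'"
  shows "S = S'" "E = E'"
proof -
  have *: "S = add_vertex w S E `` {w}" "E = add_vertex w S E \<inter> (- {w}) \<times> (- {w})"
    if "w \<notin> Field E" "w \<notin> S" for S and E :: "('a \<times> 'a) set"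
    using that by (auto simp: add_vertex_def Field_def)
  show "S = S'" using *(1)[of E S] *(1)[of E' S'] assms by metis
  show "E = E'" using *(2)[of E S] *(2)[of E' S'] assms by metis
qed

section \<open>The partition of the frontier\<close>

text \<open>
  The partitions of the frontier \<open>x, y, z\<close> (the last three vertices of the scan, in this order) into
  the components of a forest; the name lists the vertices of the block with more than one element.
\<close>

datatype links = Sep | XY | YZ | XZ | XYZ

lemma UNIV_links: "UNIV = {Sep, XY, YZ, XZ, XYZ}"
  using links.exhaust by auto

instance links :: finite
  by standard (simp add: UNIV_links)

definition linkXY :: "links \<Rightarrow> bool" where "linkXY p \<longleftrightarrow> p \<in> {XY, XYZ}"
definition linkYZ :: "links \<Rightarrow> bool" where "linkYZ p \<longleftrightarrow> p \<in> {YZ, XYZ}"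
definition linkXZ :: "links \<Rightarrow> bool" where "linkXZ p \<longleftrightarrow> p \<in> {XZ, XYZ}"

text \<open>
  If \<open>xy\<close> holds, then \<open>xz\<close> is equivalent to \<open>yz\<close>, and if only \<open>yz\<close> of these two holds, then
  \<open>xz\<close> fails; so \<open>xz\<close> carries information only if neither of the others holds.
\<close>

definition links_of :: "bool \<Rightarrow> bool \<Rightarrow> bool \<Rightarrow> links" where
  "links_of xy yz xz =
    (if xy then if yz then XYZ else XY else if yz then YZ else if xz then XZ else Sep)"

definition links :: "('a \<times> 'a) set \<Rightarrow> 'a \<Rightarrow> 'a \<Rightarrow> 'a \<Rightarrow> links" where
  "links E x y z = links_of ((x, y) \<in> E\<^sup>*) ((y, z) \<in> E\<^sup>*) ((x, z) \<in> E\<^sup>*)"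

lemma linked_iff:
  assumes "sym E"
  shows "linkXY (links E x y z) \<longleftrightarrow> (x, y) \<in> E\<^sup>*"
    and "linkYZ (links E x y z) \<longleftrightarrow> (y, z) \<in> E\<^sup>*"
    and "linkXZ (links E x y z) \<longleftrightarrow> (x, z) \<in> E\<^sup>*"
proof -
  have "(y, x) \<in> E\<^sup>* \<longleftrightarrow> (x, y) \<in> E\<^sup>*" "(z, y) \<in> E\<^sup>* \<longleftrightarrow> (y, z) \<in> E\<^sup>*"
    using sym_rtrancl_iff[OF assms] by blast+
  then have "(x, y) \<in> E\<^sup>* \<Longrightarrow> (y, z) \<in> E\<^sup>* \<longleftrightarrow> (x, z) \<in> E\<^sup>*" "(x, z) \<in> E\<^sup>* \<Longrightarrow> (y, z) \<in> E\<^sup>* \<longleftrightarrow> (x, y) \<in> E\<^sup>*"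
    using sym_rtrancl_iff[OF assms, of z] by (meson rtrancl_trans)+
  then show "linkXY (links E x y z) \<longleftrightarrow> (x, y) \<in> E\<^sup>*"
    "linkYZ (links E x y z) \<longleftrightarrow> (y, z) \<in> E\<^sup>*" "linkXZ (links E x y z) \<longleftrightarrow> (x, z) \<in> E\<^sup>*"
    by (simp_all add: links_def links_of_def linkXY_def linkYZ_def linkXZ_def)
qed

text \<open>
  The new vertex is attached to those of \<open>x, y, z\<close> for which \<open>a, b, c\<close> hold. Connected vertices must
  not both be chosen, or there would be a cycle. After the step \<open>x\<close> leaves the frontier, so if it is a
  vertex that has to be covered (\<open>d\<close>), its component must keep another vertex of the frontier.
\<close>

definition admissible :: "bool \<Rightarrow> bool \<Rightarrow> bool \<Rightarrow> bool \<Rightarrow> links \<Rightarrow> bool" where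
  "admissible d a b c p \<longleftrightarrow>
    \<not> (a \<and> b \<and> linkXY p) \<and> \<not> (b \<and> c \<and> linkYZ p) \<and> \<not> (a \<and> c \<and> linkXZ p) \<and>
    (d \<longrightarrow> a \<or> linkXY p \<or> linkXZ p)"

text \<open>
  The partition of the new frontier \<open>y, z, w\<close>; the local variables tell whether \<open>y\<close> and \<open>z\<close> become
  connected to \<open>w\<close>.
\<close>

definition attach :: "bool \<Rightarrow> bool \<Rightarrow> bool \<Rightarrow> links \<Rightarrow> links" where
  "attach a b c p =
    (let y = b \<or> a \<and> linkXY p \<or> c \<and> linkYZ p; z = c \<or> b \<and> linkYZ p \<or> a \<and> linkXZ p
     in links_of (linkYZ p \<or> y \<and> z) z y)"

lemma links_add_vertex:
  assumes E: "sym E" and w: "w \<notin> Field E" "w \<notin> {x, y, z}" and S: "S \<subseteq> {x, y, z}"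
  shows "links (add_vertex w S E) y z w = attach (x \<in> S) (y \<in> S) (z \<in> S) (links E x y z)"
proof -
  have ex: "(\<exists>s\<in>S. P s) \<longleftrightarrow> x \<in> S \<and> P x \<or> y \<in> S \<and> P y \<or> z \<in> S \<and> P z" for P
    using S by blast
  have eqv: "(x, x) \<in> E\<^sup>*" "(y, y) \<in> E\<^sup>*" "(z, z) \<in> E\<^sup>*" "(y, x) \<in> E\<^sup>* \<longleftrightarrow> (x, y) \<in> E\<^sup>*"
    "(z, x) \<in> E\<^sup>* \<longleftrightarrow> (x, z) \<in> E\<^sup>*" "(z, y) \<in> E\<^sup>* \<longleftrightarrow> (y, z) \<in> E\<^sup>*"
    using sym_rtrancl_iff[OF E] by auto
  have "(y, z) \<in> (add_vertex w S E)\<^sup>* \<longleftrightarrow> (y, z) \<in> E\<^sup>* \<or>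
      (\<exists>s\<in>S. (y, s) \<in> E\<^sup>*) \<and> (\<exists>s\<in>S. (s, z) \<in> E\<^sup>*)"
    "(y, w) \<in> (add_vertex w S E)\<^sup>* \<longleftrightarrow> (\<exists>s\<in>S. (y, s) \<in> E\<^sup>*)"
    "(z, w) \<in> (add_vertex w S E)\<^sup>* \<longleftrightarrow> (\<exists>s\<in>S. (z, s) \<in> E\<^sup>*)"
    using reach_add_vertex[OF w(1) E, of y _ S] reach_add_vertex[OF w(1) E, of z _ S] w(2) by auto
  then show ?thesis
    unfolding links_def[of "add_vertex w S E"] attach_def linked_iff[OF E] Let_def ex
    by (auto simp: eqv intro!: arg_cong3[where f = links_of])
qed

section \<open>The transfer step\<close>

text \<open>
  The partial trees. The set \<open>U\<close> of vertices to be covered need not contain the frontier: this allows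
  a scan to start with isolated dummy vertices in the frontier, which are dropped again.
\<close>

definition forests :: "('a \<times> 'a) set \<Rightarrow> 'a set \<Rightarrow> 'a \<Rightarrow> 'a \<Rightarrow> 'a \<Rightarrow> links \<Rightarrow> ('a \<times> 'a) set set" where
  "forests G U x y z p =
    {E. E \<subseteq> G \<and> sym E \<and> all_bridges E \<and> (\<forall>u\<in>U. \<exists>s\<in>{x, y, z}. (u, s) \<in> E\<^sup>*) \<and> links E x y z = p}"

definition moves :: "bool \<Rightarrow> 'a set \<Rightarrow> 'a \<Rightarrow> 'a \<Rightarrow> 'a \<Rightarrow> links \<Rightarrow> ((bool \<times> bool \<times> bool) \<times> links) set" where
  "moves d N x y z q = {((a, b, c), p). (a \<longrightarrow> x \<in> N) \<and> (b \<longrightarrow> y \<in> N) \<and> (c \<longrightarrow> z \<in> N) \<and>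
     admissible d a b c p \<and> attach a b c p = q}"

text \<open>
  The components have to meet the frontier both before and after the step. The only component that can
  lose its contact is that of \<open>x\<close>. A dummy \<open>x\<close> outside \<open>U\<close> is isolated, so that no vertex of \<open>U\<close>
  relies on it.
\<close>

lemma covered_add_vertex:
  assumes E: "sym E" "E \<subseteq> G" and w: "w \<notin> Field E" "w \<notin> {x, y, z}" "w \<notin> U" and S: "S \<subseteq> {x, y, z}"
    and x: "x \<in> U \<or> x \<notin> Field G"
  shows "(\<forall>u\<in>insert w U. \<exists>s\<in>{y, z, w}. (u, s) \<in> (add_vertex w S E)\<^sup>*) \<longleftrightarrow>
    (\<forall>u\<in>U. \<exists>s\<in>{x, y, z}. (u, s) \<in> E\<^sup>*) \<and>
    (x \<in> U \<longrightarrow> x \<in> S \<or> (x, y) \<in> E\<^sup>* \<or> (x, z) \<in> E\<^sup>*)" (is "?L \<longleftrightarrow> ?R1 \<and> ?R2")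
proof -
  have reach: "(\<exists>s\<in>{y, z, w}. (u, s) \<in> (add_vertex w S E)\<^sup>*) \<longleftrightarrow>
      (u, y) \<in> E\<^sup>* \<or> (u, z) \<in> E\<^sup>* \<or> (\<exists>s\<in>S. (u, s) \<in> E\<^sup>*)" if "u \<in> U" for u
  proof -
    have "u \<noteq> w" using that w by blast
    from reach_add_vertex[OF w(1) E(1) this, of _ S] show ?thesis using w(2) by auto
  qed
  have L: "?L \<longleftrightarrow> (\<forall>u\<in>U. (u, y) \<in> E\<^sup>* \<or> (u, z) \<in> E\<^sup>* \<or> (\<exists>s\<in>S. (u, s) \<in> E\<^sup>*))"
    unfolding ball_simps(7) using reach by (simp cong: ball_cong)
  show ?thesis
  proof
    assume ?L
    have *: "(u, y) \<in> E\<^sup>* \<or> (u, z) \<in> E\<^sup>* \<or> (\<exists>s\<in>S. (u, s) \<in> E\<^sup>*)" if "u \<in> U" for u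
      using \<open>?L\<close>[unfolded L] that by (rule bspec)
    have ?R1 using * S by blast
    moreover have ?R2
    proof
      assume "x \<in> U"
      from *[OF this] S show "x \<in> S \<or> (x, y) \<in> E\<^sup>* \<or> (x, z) \<in> E\<^sup>*" by blast
    qed
    ultimately show "?R1 \<and> ?R2" ..
  next
    assume R: "?R1 \<and> ?R2"
    have "(u, y) \<in> E\<^sup>* \<or> (u, z) \<in> E\<^sup>* \<or> (\<exists>s\<in>S. (u, s) \<in> E\<^sup>*)" if u: "u \<in> U" for u
    proof -
      consider "(u, y) \<in> E\<^sup>* \<or> (u, z) \<in> E\<^sup>*" | "(u, x) \<in> E\<^sup>*" using R u by blast
      then show ?thesis
      proof cases
        case 2
        have "x \<in> U"
        proof (rule ccontr)
          assume "x \<notin> U"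
          then have "u \<noteq> x" "x \<notin> Field E" using u x E(2) by (auto simp: Field_def)
          with 2 show False by (auto simp: Field_def elim: rtranclE)
        qed
        then have "x \<in> S \<or> (x, y) \<in> E\<^sup>* \<or> (x, z) \<in> E\<^sup>*" using R by blast
        then show ?thesis using rtrancl_trans[OF 2, of y] rtrancl_trans[OF 2, of z] 2 by auto
      qed auto
    qed
    then show ?L unfolding L by (intro ballI)
  qed
qed

lemma forests_add_vertex_iff:
  assumes w: "w \<notin> Field G" "w \<notin> {x, y, z}" "w \<notin> U" and N: "N \<subseteq> {x, y, z}"
    and x: "x \<in> U \<or> x \<notin> Field G" and E: "E \<subseteq> G" "sym E" and S: "S \<subseteq> N"
    and dist: "distinct [x, y, z]"
  shows "add_vertex w S E \<in> forests (add_vertex w N G) (insert w U) y z w q \<longleftrightarrow>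
    (\<exists>p. E \<in> forests G U x y z p \<and> admissible (x \<in> U) (x \<in> S) (y \<in> S) (z \<in> S) p \<and>
         attach (x \<in> S) (y \<in> S) (z \<in> S) p = q)"
proof -
  have wE: "w \<notin> Field E" and SX: "S \<subseteq> {x, y, z}" and wS: "w \<notin> S"
    using assms by (auto simp: Field_def)
  have indep: "(\<forall>s\<in>S. \<forall>s'\<in>S. (s, s') \<in> E\<^sup>* \<longrightarrow> s = s') \<longleftrightarrow>
      \<not> (x \<in> S \<and> y \<in> S \<and> (x, y) \<in> E\<^sup>*) \<and> \<not> (y \<in> S \<and> z \<in> S \<and> (y, z) \<in> E\<^sup>*) \<and>
      \<not> (x \<in> S \<and> z \<in> S \<and> (x, z) \<in> E\<^sup>*)" (is "?A \<longleftrightarrow> ?B")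
  proof
    assume ?A then show ?B using dist by auto
  next
    assume B: ?B
    show ?A
    proof (intro ballI impI)
      fix s s' assume s: "s \<in> S" "s' \<in> S" and r: "(s, s') \<in> E\<^sup>*"
      have "(s', s) \<in> E\<^sup>*" using r sym_rtrancl_iff[OF E(2)] by blast
      moreover have "s = x \<or> s = y \<or> s = z" "s' = x \<or> s' = y \<or> s' = z" using s SX by auto
      ultimately show "s = s'" using B s r by metis
    qed
  qed
  have sub: "add_vertex w S E \<subseteq> add_vertex w N G" using E S by (auto simp: add_vertex_def)
  have "add_vertex w S E \<in> forests (add_vertex w N G) (insert w U) y z w q \<longleftrightarrow>
      E \<in> forests G U x y z (links E x y z) \<and>
      admissible (x \<in> U) (x \<in> S) (y \<in> S) (z \<in> S) (links E x y z) \<and>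
      attach (x \<in> S) (y \<in> S) (z \<in> S) (links E x y z) = q"
    unfolding forests_def mem_Collect_eq admissible_def
      all_bridges_add_vertex[OF wE wS E(2)] links_add_vertex[OF E(2) wE w(2) SX] indep
      covered_add_vertex[OF E(2,1) wE w(2,3) SX x] linked_iff[OF E(2)]
    using sub E sym_add_vertex[OF E(2)] by blast
  moreover have "E \<in> forests G U x y z p \<Longrightarrow> p = links E x y z" for p
    by (simp add: forests_def)
  ultimately show ?thesis by blast
qed

text \<open>
  Deleting \<open>w\<close> from a forest on the larger graph leaves a forest on the smaller one together with the set of
  neighbours of \<open>w\<close>, and the forest can be rebuilt from both. Sorting by partitions turns this
  bijection into a linear recurrence, with coefficients that depend only on which of
  \<open>x, y, z\<close> are adjacent to \<open>w\<close>.
\<close>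

lemma card_forests_add_vertex:
  fixes G :: "('a \<times> 'a) set"
  assumes w: "w \<notin> Field G" "w \<notin> {x, y, z}" "w \<notin> U" and N: "N \<subseteq> {x, y, z}"
    and x: "x \<in> U \<or> x \<notin> Field G" and G: "finite G" and dist: "distinct [x, y, z]"
  shows "card (forests (add_vertex w N G) (insert w U) y z w q) =
    (\<Sum>(s, p)\<in>moves (x \<in> U) N x y z q. card (forests G U x y z p))"
proof -
  (* the set of neighbours that is encoded by three truth values *)
  define sel where "sel = (\<lambda>(a, b, c). {s. a \<and> s = x \<or> b \<and> s = y \<or> c \<and> s = z})"
  let ?I = "moves (x \<in> U) N x y z q"
  let ?F = "Sigma ?I (\<lambda>(s, p). forests G U x y z p)"
  have mem_sel: "x \<in> sel (a, b, c) \<longleftrightarrow> a" "y \<in> sel (a, b, c) \<longleftrightarrow> b" "z \<in> sel (a, b, c) \<longleftrightarrow> c"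
    for a b c using dist by (auto simp: sel_def)
  have w_sel: "w \<notin> sel s" for s using w by (auto simp: sel_def)
  have sel_N: "sel s \<subseteq> N" if "(s, p) \<in> ?I" for s p
    using that by (auto simp: sel_def moves_def)
  have wE: "w \<notin> Field E" if "E \<subseteq> G" for E using that w by (auto simp: Field_def)
  have "bij_betw (\<lambda>((s, p), E). add_vertex w (sel s) E) ?F (forests (add_vertex w N G) (insert w U) y z w q)"
    unfolding bij_betw_def
  proof
    show "inj_on (\<lambda>((s, p), E). add_vertex w (sel s) E) ?F"
    proof (rule inj_onI)
      fix t t' assume t: "t \<in> ?F" "t' \<in> ?F"
        and "(\<lambda>((s, p), E). add_vertex w (sel s) E) t = (\<lambda>((s, p), E). add_vertex w (sel s) E) t'"
      moreover obtain a b c p E where t1: "t = (((a, b, c), p), E)" by (cases t) auto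
      moreover obtain a' b' c' p' E' where t2: "t' = (((a', b', c'), p'), E')" by (cases t') auto
      ultimately have E: "E \<in> forests G U x y z p" "E' \<in> forests G U x y z p'"
        and eq: "add_vertex w (sel (a, b, c)) E = add_vertex w (sel (a', b', c')) E'" by auto
      have "E \<subseteq> G" "E' \<subseteq> G" using E by (auto simp: forests_def)
      note inj = add_vertex_inject[OF wE[OF this(1)] w_sel wE[OF this(2)] w_sel eq]
      have "p = p'" using E inj(2) by (auto simp: forests_def)
      moreover have "a = a' \<and> b = b' \<and> c = c'" using inj(1) mem_sel by metis
      ultimately show "t = t'" using inj(2) t1 t2 by simp
    qed
    show "(\<lambda>((s, p), E). add_vertex w (sel s) E) ` ?F = forests (add_vertex w N G) (insert w U) y z w q"
    proof (intro equalityI subsetI)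
      fix E' assume "E' \<in> (\<lambda>((s, p), E). add_vertex w (sel s) E) ` ?F"
      then obtain a b c p E where E: "((a, b, c), p) \<in> ?I" "E \<in> forests G U x y z p"
        and E': "E' = add_vertex w (sel (a, b, c)) E" by auto
      have "E \<subseteq> G" "sym E" using E by (auto simp: forests_def)
      then show "E' \<in> forests (add_vertex w N G) (insert w U) y z w q"
        unfolding E' using E
        by (subst forests_add_vertex_iff[OF w N x _ _ sel_N[OF E(1)] dist])
           (auto simp: mem_sel moves_def)
    next
      fix E' assume E': "E' \<in> forests (add_vertex w N G) (insert w U) y z w q"
      define S where "S = E' `` {w}"
      define E where "E = E' \<inter> (- {w}) \<times> (- {w})"
      have sub: "E' \<subseteq> add_vertex w N G" and sym: "sym E'" using E' by (auto simp: forests_def)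
      have new: "(w, v) \<in> E' \<Longrightarrow> v \<in> N" for v
      proof -
        assume "(w, v) \<in> E'"
        then have "(w, v) \<in> G \<or> v \<in> N \<or> w \<in> N" using sub by (auto simp: add_vertex_def)
        then show "v \<in> N" using w N by (blast intro: FieldI1)
      qed
      then have S: "S \<subseteq> N" and loop: "(w, w) \<notin> E'"
        using w N by (auto simp: S_def)
      have EG: "E \<subseteq> G" using sub unfolding E_def add_vertex_def by blast
      have dec: "E' = add_vertex w S E"
        unfolding S_def E_def by (rule add_vertex_delete[OF sym loop])
      have symE: "sym E" using sym by (auto simp: E_def sym_def)
      obtain p where p: "E \<in> forests G U x y z p" "admissible (x \<in> U) (x \<in> S) (y \<in> S) (z \<in> S) p"
          "attach (x \<in> S) (y \<in> S) (z \<in> S) p = q"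
        using E' forests_add_vertex_iff[OF w N x EG symE S dist] dec by auto
      have "S = sel (x \<in> S, y \<in> S, z \<in> S)" using S N by (auto simp: sel_def)
      moreover have "((x \<in> S, y \<in> S, z \<in> S), p) \<in> ?I" using p S by (auto simp: moves_def)
      ultimately show "E' \<in> (\<lambda>((s, p), E). add_vertex w (sel s) E) ` ?F"
        using p dec by (intro image_eqI[of _ _ "(((x \<in> S, y \<in> S, z \<in> S), p), E)"]) auto
    qed
  qed
  then have "card (forests (add_vertex w N G) (insert w U) y z w q) = card ?F"
    by (metis bij_betw_same_card)
  also have "\<dots> = (\<Sum>(s, p)\<in>?I. card (forests G U x y z p))"
  proof -
    have "finite (forests G U x y z p)" for p
      by (rule finite_subset[of _ "Pow G"]) (use G in \<open>auto simp: forests_def\<close>)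
    then show ?thesis by (subst card_SigmaI) (auto simp: case_prod_beta)
  qed
  finally show ?thesis .
qed

text \<open>
  The coefficients of the recurrence if the new vertex is adjacent to all of \<open>x, y, z\<close>, and if it is
  adjacent to \<open>y\<close> and \<open>z\<close> only. Both maps are needed on natural numbers and on power series.
\<close>

fun full_step :: "(links \<Rightarrow> 'a::comm_semiring_1) \<Rightarrow> links \<Rightarrow> 'a" where
  "full_step f Sep = f Sep + f XY + f XZ"
| "full_step f XY = f YZ + f XYZ"
| "full_step f YZ = f Sep + f XY + 2 * f XZ"
| "full_step f XZ = f Sep + 2 * f XY + f XZ"
| "full_step f XYZ = f Sep + 2 * f XY + 2 * f YZ + 2 * f XZ + 3 * f XYZ"

fun short_step :: "(links \<Rightarrow> 'a::comm_semiring_1) \<Rightarrow> links \<Rightarrow> 'a" where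
  "short_step f Sep = f XY + f XZ"
| "short_step f XY = f XYZ"
| "short_step f YZ = f XY + f XZ"
| "short_step f XZ = f XY + f XZ"
| "short_step f XYZ = f XY + f XZ + 2 * f XYZ"

lemma sum_moves:
  "(\<Sum>(s, p)\<in>moves d N x y z q. f p) =
    (\<Sum>a\<in>UNIV. \<Sum>b\<in>UNIV. \<Sum>c\<in>UNIV. \<Sum>p\<in>UNIV. if (a \<longrightarrow> x \<in> N) \<and> (b \<longrightarrow> y \<in> N) \<and> (c \<longrightarrow> z \<in> N) \<and>
     admissible d a b c p \<and> attach a b c p = q then f p else (0::nat))"
proof -
  have "(\<Sum>(s, p)\<in>moves d N x y z q. f p) =
    (\<Sum>((a, b, c), p)\<in>UNIV. if ((a, b, c), p) \<in> moves d N x y z q then f p else 0)"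
    by (rule sum.mono_neutral_cong_left) auto
  also have "\<dots> = (\<Sum>((a, b, c), p)\<in>(UNIV \<times> UNIV \<times> UNIV) \<times> UNIV.
      if ((a, b, c), p) \<in> moves d N x y z q then f p else 0)"
    by simp
  also have "\<dots> = (\<Sum>a\<in>UNIV. \<Sum>b\<in>UNIV. \<Sum>c\<in>UNIV. \<Sum>p\<in>UNIV.
      if ((a, b, c), p) \<in> moves d N x y z q then f p else 0)"
    by (simp only: sum.cartesian_product' split_conv)
  finally show ?thesis by (simp add: moves_def)
qed

lemma card_forests_full_step:
  assumes w: "w \<notin> Field G" "w \<notin> {x, y, z}" "w \<notin> U"
    and x: "x \<in> U" and G: "finite G" and dist: "distinct [x, y, z]"
  shows "(\<lambda>q. card (forests (add_vertex w {x, y, z} G) (insert w U) y z w q)) =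
    full_step (\<lambda>p. card (forests G U x y z p))"
proof
  fix q
  show "card (forests (add_vertex w {x, y, z} G) (insert w U) y z w q) =
    full_step (\<lambda>p. card (forests G U x y z p)) q"
    using x by (subst card_forests_add_vertex[OF w _ _ G dist], simp_all add: sum_moves, cases q)
       (simp_all add: UNIV_bool UNIV_links
         admissible_def attach_def links_of_def linkXY_def linkYZ_def linkXZ_def)
qed

lemma card_forests_short_step:
  assumes w: "w \<notin> Field G" "w \<notin> {x, y, z}" "w \<notin> U"
    and x: "x \<in> U" and G: "finite G" and dist: "distinct [x, y, z]"
  shows "(\<lambda>q. card (forests (add_vertex w {y, z} G) (insert w U) y z w q)) =
    short_step (\<lambda>p. card (forests G U x y z p))"
proof
  fix q
  show "card (forests (add_vertex w {y, z} G) (insert w U) y z w q) =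
    short_step (\<lambda>p. card (forests G U x y z p)) q"
    using x dist by (subst card_forests_add_vertex[OF w _ _ G dist], simp_all add: sum_moves, cases q)
       (simp_all add: UNIV_bool UNIV_links
         admissible_def attach_def links_of_def linkXY_def linkYZ_def linkXZ_def)
qed

fun triangle_census :: "links \<Rightarrow> 'a::comm_semiring_1" where
  "triangle_census Sep = 1"
| "triangle_census XY = 1"
| "triangle_census YZ = 1"
| "triangle_census XZ = 1"
| "triangle_census XYZ = 3"

section \<open>Spanning trees of a path cube with one vertex deleted\<close>

text \<open>
  The scan starts at \<open>i\<close> with two dummy vertices \<open>a\<close> and \<open>b\<close> in the frontier, which leave it when \<open>j\<close>
  and \<open>k\<close> are added.
\<close>

lemma card_forests_triangle:
  fixes i j k :: nat
  assumes ijk: "distinct [i, j, k]"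
  shows "card (forests (add_vertex k {i, j} (add_vertex j {i} {})) {i, j, k} i j k q) = triangle_census q"
proof -
  (* any two further vertices would do *)
  define a b where "a = i + j + k + 1" and "b = i + j + k + 2"
  then have ne: "i \<noteq> a" "j \<noteq> a" "k \<noteq> a" "i \<noteq> b" "j \<noteq> b" "k \<noteq> b" "a \<noteq> b"
      "a \<noteq> i" "b \<noteq> i" "b \<noteq> j" "b \<noteq> a"
      "i \<noteq> j" "i \<noteq> k" "j \<noteq> k" "j \<noteq> i" "k \<noteq> i" "k \<noteq> j"
    using ijk by auto
  have 0: "card (forests {} {i} a b i q) = (if q = Sep then 1 else 0)" for q
  proof -
    have "forests {} {i} a b i q = (if q = Sep then {{}} else {})"
      using ne by (auto simp: forests_def links_def links_of_def all_bridges_def sym_def)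
    then show ?thesis by simp
  qed
  have 1: "card (forests (add_vertex j {i} {}) (insert j {i}) b i j q) =
      (if q = Sep \<or> q = YZ then 1 else 0)" for q
  proof -
    have "card (forests (add_vertex j {i} {}) (insert j {i}) b i j q) =
        (\<Sum>(s, p)\<in>moves False {i} a b i q. card (forests {} {i} a b i p))"
      using card_forests_add_vertex[of j "{}" a b i "{i}" "{i}" q] ne by simp
    then show ?thesis
      using ne unfolding 0 sum_moves
      by (cases q) (simp_all add: UNIV_bool UNIV_links
          admissible_def attach_def links_of_def linkXY_def linkYZ_def linkXZ_def)
  qed
  have "card (forests (add_vertex k {i, j} (add_vertex j {i} {})) (insert k (insert j {i})) i j k q) =
      (\<Sum>(s, p)\<in>moves False {i, j} b i j q. card (forests (add_vertex j {i} {}) (insert j {i}) b i j p))"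
    using card_forests_add_vertex[of k "add_vertex j {i} {}" b i j "insert j {i}" "{i, j}" q] ne
    by (auto simp: add_vertex_def)
  also have "\<dots> = triangle_census q"
    using ne unfolding 1 sum_moves
    by (cases q) (simp_all add: UNIV_bool UNIV_links
        admissible_def attach_def links_of_def linkXY_def linkYZ_def linkXZ_def)
  finally have "card (forests (add_vertex k {i, j} (add_vertex j {i} {})) (insert k (insert j {i})) i j k q) =
      triangle_census q" .
  moreover have "insert k (insert j {i}) = {i, j, k}" by auto
  ultimately show ?thesis by simp
qed

definition cube_adj :: "nat \<Rightarrow> nat \<Rightarrow> bool" where
  "cube_adj i j \<longleftrightarrow> i \<noteq> j \<and> i \<le> j + 3 \<and> j \<le> i + 3"

definition cube :: "nat set \<Rightarrow> (nat \<times> nat) set" where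
  "cube V = {(i, j). i \<in> V \<and> j \<in> V \<and> cube_adj i j}"

definition census :: "nat set \<Rightarrow> nat \<Rightarrow> nat \<Rightarrow> nat \<Rightarrow> links \<Rightarrow> nat" where
  "census V x y z = (\<lambda>p. card (forests (cube V) V x y z p))"

lemma cube_insert: "w \<notin> V \<Longrightarrow> cube (insert w V) = add_vertex w {s \<in> V. cube_adj s w} (cube V)"
  by (auto simp: cube_def add_vertex_def cube_adj_def)

lemma finite_cube: "finite V \<Longrightarrow> finite (cube V)"
  by (rule finite_subset[of _ "V \<times> V"]) (auto simp: cube_def)

lemma Field_cube: "Field (cube V) \<subseteq> V"
  by (auto simp: cube_def Field_def)

lemma census_full_step:
  assumes "finite V" "w \<notin> V" "x \<in> V" "{s \<in> V. cube_adj s w} = {x, y, z}" "distinct [x, y, z]"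
  shows "census (insert w V) y z w = full_step (census V x y z)"
proof -
  have "y \<in> V" "z \<in> V" using assms(4) by blast+
  then have "w \<notin> {x, y, z}" "w \<notin> Field (cube V)" using assms(2,3) Field_cube by blast+
  then show ?thesis
    unfolding census_def cube_insert[OF assms(2)] assms(4)
    by (rule card_forests_full_step[OF _ _ assms(2,3) finite_cube[OF assms(1)] assms(5), rotated])
qed

lemma census_short_step:
  assumes "finite V" "w \<notin> V" "x \<in> V" "{s \<in> V. cube_adj s w} = {y, z}" "distinct [x, y, z]"
  shows "census (insert w V) y z w = short_step (census V x y z)"
proof -
  have "y \<in> V" "z \<in> V" using assms(4) by blast+
  then have "w \<notin> {x, y, z}" "w \<notin> Field (cube V)" using assms(2,3) Field_cube by blast+
  then show ?thesis
    unfolding census_def cube_insert[OF assms(2)] assms(4)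
    by (rule card_forests_short_step[OF _ _ assms(2,3) finite_cube[OF assms(1)] assms(5), rotated])
qed

lemma census_triangle:
  assumes "distinct [i, j, k]" "cube_adj i j" "cube_adj i k" "cube_adj j k"
  shows "census {i, j, k} i j k = triangle_census"
proof -
  have "cube {i, j, k} = add_vertex k {i, j} (add_vertex j {i} {})"
    using assms by (auto simp: cube_def add_vertex_def cube_adj_def)
  then show ?thesis using card_forests_triangle[OF assms(1)] by (auto simp: census_def)
qed

text \<open>
  After a stretch of three consecutive vertices the frontier has no gap, so every further step is full.
\<close>

lemma census_extend:
  assumes "V \<subseteq> {..m + 3}" "{m + 1, m + 2, m + 3} \<subseteq> V"
  shows "census (V \<union> {m + 4..m + 3 + k}) (m + k + 1) (m + k + 2) (m + k + 3) =
    (full_step ^^ k) (census V (m + 1) (m + 2) (m + 3))"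
proof (induction k)
  case 0
  then show ?case by simp
next
  case (Suc k)
  let ?W = "V \<union> {m + 4..m + 3 + k}"
  have "finite V" using assms(1) by (rule finite_subset) simp
  moreover have "{s \<in> ?W. cube_adj s (m + k + 4)} = {m + k + 1, m + k + 2, m + k + 3}"
  proof
    show "{s \<in> ?W. cube_adj s (m + k + 4)} \<subseteq> {m + k + 1, m + k + 2, m + k + 3}"
      using assms(1) by (auto simp: cube_adj_def)
    have mem: "i \<in> ?W" if "m + k + 1 \<le> i" "i \<le> m + k + 3" for i
    proof (cases "i \<le> m + 3")
      case True
      then have "i = m + 1 \<or> i = m + 2 \<or> i = m + 3" using that by auto
      then show ?thesis using assms(2) by auto
    qed (use that in auto)
    have "{m + k + 1, m + k + 2, m + k + 3} \<subseteq> ?W"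
      using mem[of "m + k + 1"] mem[of "m + k + 2"] mem[of "m + k + 3"] by simp
    then show "{m + k + 1, m + k + 2, m + k + 3} \<subseteq> {s \<in> ?W. cube_adj s (m + k + 4)}"
      by (simp add: cube_adj_def)
  qed
  ultimately have "census (insert (m + k + 4) ?W) (m + k + 2) (m + k + 3) (m + k + 4) =
      full_step (census ?W (m + k + 1) (m + k + 2) (m + k + 3))"
    using assms(1) by (intro census_full_step) auto
  moreover have "insert (m + k + 4) ?W = V \<union> {m + 4..m + 3 + Suc k}" by auto
  ultimately show ?case using Suc.IH by (simp add: numeral_eq_Suc)
qed

lemma census_path:
  "census {1..m + 3} (m + 1) (m + 2) (m + 3) = (full_step ^^ m) triangle_census"
proof -
  have 0: "{1, 2, 3} \<union> {0 + 4..0 + 3 + m} = {1..m + 3}" by auto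
  have 1: "census {1, 2, 3} (0 + 1) (0 + 2) (0 + 3) = triangle_census"
  proof -
    have sums: "0 + 1 = (1::nat)" "0 + 2 = (2::nat)" "0 + 3 = (3::nat)" by simp_all
    show ?thesis unfolding sums by (rule census_triangle) (auto simp: cube_adj_def)
  qed
  have "census ({1, 2, 3} \<union> {0 + 4..0 + 3 + m}) (0 + m + 1) (0 + m + 2) (0 + m + 3) =
      (full_step ^^ m) (census {1, 2, 3} (0 + 1) (0 + 2) (0 + 3))"
    by (rule census_extend) auto
  then show ?thesis unfolding 0 1 by simp
qed

text \<open>
  Because of the gap at \<open>m + 4\<close>, each of the next three vertices is at distance four from the oldest
  vertex of the frontier, while it is adjacent to the other two.
\<close>

lemma census_gap1:
  "census (insert (m + 5) {1..m + 3}) (m + 2) (m + 3) (m + 5) =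
    short_step ((full_step ^^ m) triangle_census)"
  unfolding census_path[symmetric]
  by (rule census_short_step) (auto simp: cube_adj_def)

lemma census_gap2:
  "census (insert (m + 6) (insert (m + 5) {1..m + 3})) (m + 3) (m + 5) (m + 6) =
    (short_step ^^ 2) ((full_step ^^ m) triangle_census)"
proof -
  have "census (insert (m + 6) (insert (m + 5) {1..m + 3})) (m + 3) (m + 5) (m + 6) =
      short_step (census (insert (m + 5) {1..m + 3}) (m + 2) (m + 3) (m + 5))"
    by (rule census_short_step) (auto simp: cube_adj_def)
  then show ?thesis unfolding census_gap1 by (simp add: numeral_2_eq_2)
qed

lemma census_gap3:
  "census (insert (m + 7) (insert (m + 6) (insert (m + 5) {1..m + 3}))) (m + 5) (m + 6) (m + 7) =
    (short_step ^^ 3) ((full_step ^^ m) triangle_census)"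
proof -
  have "census (insert (m + 7) (insert (m + 6) (insert (m + 5) {1..m + 3}))) (m + 5) (m + 6) (m + 7) =
      short_step (census (insert (m + 6) (insert (m + 5) {1..m + 3})) (m + 3) (m + 5) (m + 6))"
    by (rule census_short_step) (auto simp: cube_adj_def)
  then show ?thesis unfolding census_gap2 by (simp add: numeral_3_eq_3 numeral_2_eq_2)
qed

definition trees :: "('a \<times> 'a) set \<Rightarrow> 'a set \<Rightarrow> ('a \<times> 'a) set set" where
  "trees G V = {E. E \<subseteq> G \<and> sym E \<and> all_bridges E \<and> (\<forall>u\<in>V. \<forall>v\<in>V. (u, v) \<in> E\<^sup>*)}"

text \<open>
  Every vertex reaches the frontier and the frontier is one block, so any two vertices are connected
  through it.
\<close>

lemma trees_eq_forests:
  assumes "{x, y, z} \<subseteq> V"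
  shows "trees G V = forests G V x y z XYZ"
proof -
  have "(\<forall>u\<in>V. \<forall>v\<in>V. (u, v) \<in> E\<^sup>*) \<longleftrightarrow>
      (\<forall>u\<in>V. \<exists>s\<in>{x, y, z}. (u, s) \<in> E\<^sup>*) \<and> links E x y z = XYZ" (is "?L \<longleftrightarrow> ?R")
    if E: "sym E" for E
  proof
    assume ?L then show ?R using assms by (auto simp: links_def links_of_def)
  next
    assume R: ?R
    have "linkXY (links E x y z)" "linkXZ (links E x y z)"
      using R by (auto simp: linkXY_def linkXZ_def)
    then have "(x, y) \<in> E\<^sup>*" "(x, z) \<in> E\<^sup>*" using linked_iff[OF E] by blast+
    then have x: "(x, s) \<in> E\<^sup>*" if "s \<in> {x, y, z}" for s using that by auto
    have "(u, x) \<in> E\<^sup>*" if u: "u \<in> V" for u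
    proof -
      obtain s where s: "s \<in> {x, y, z}" "(u, s) \<in> E\<^sup>*" using R u by blast
      have "(s, x) \<in> E\<^sup>*" using x[OF s(1)] sym_rtrancl_iff[OF E] by blast
      with s(2) show ?thesis by (rule rtrancl_trans)
    qed
    then show ?L using sym_rtrancl_iff[OF E] by (meson rtrancl_trans)
  qed
  then show ?thesis unfolding trees_def forests_def by blast
qed

definition tree_count :: "nat set \<Rightarrow> nat" where
  "tree_count V = card (trees (cube V) V)"

lemma tree_count_census: "{x, y, z} \<subseteq> V \<Longrightarrow> tree_count V = census V x y z XYZ"
  by (simp add: tree_count_def census_def trees_eq_forests)

lemma tree_count_path: "tree_count {1..m + 3} = (full_step ^^ m) triangle_census XYZ"
  unfolding census_path[symmetric] by (rule tree_count_census) auto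

lemma tree_count_extend:
  assumes "V \<subseteq> {..m + 3}" "{m + 1, m + 2, m + 3} \<subseteq> V"
    and W: "W = V \<union> {m + 4..m + 3 + k}"
  shows "tree_count W = (full_step ^^ k) (census V (m + 1) (m + 2) (m + 3)) XYZ"
proof -
  have "i \<in> W" if "m + k + 1 \<le> i" "i \<le> m + k + 3" for i
  proof (cases "i \<le> m + 3")
    case True
    then have "i = m + 1 \<or> i = m + 2 \<or> i = m + 3" using that by auto
    then show ?thesis using assms(2) W by auto
  qed (use that W in auto)
  then have "tree_count W = census W (m + k + 1) (m + k + 2) (m + k + 3) XYZ"
    by (intro tree_count_census) simp
  then show ?thesis unfolding W census_extend[OF assms(1,2)] .
qed

text \<open>
  Near the left end some vertices of the frontier are missing, so that a new vertex is adjacent to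
  all the others: a step after the gap is short only once three vertices precede it.
\<close>

lemma tree_count_delete_first:
  "tree_count ({1..m + 4} - {1}) = (full_step ^^ m) triangle_census XYZ"
proof -
  have "tree_count ({1..m + 4} - {1}) = (full_step ^^ m) (census {2, 3, 4} (1 + 1) (1 + 2) (1 + 3)) XYZ"
    by (rule tree_count_extend) auto
  also have "census {2, 3, 4} (1 + 1) (1 + 2) (1 + 3) = triangle_census"
  proof -
    have sums: "1 + 1 = (2::nat)" "1 + 2 = (3::nat)" "1 + 3 = (4::nat)" by simp_all
    show ?thesis unfolding sums by (rule census_triangle) (auto simp: cube_adj_def)
  qed
  finally show ?thesis .
qed

lemma tree_count_delete_second:
  "tree_count ({1..m + 5} - {2}) = (full_step ^^ m) (short_step triangle_census) XYZ"
proof -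
  have "tree_count ({1..m + 5} - {2}) =
      (full_step ^^ m) (census (insert 5 {1, 3, 4}) (2 + 1) (2 + 2) (2 + 3)) XYZ"
    by (rule tree_count_extend) auto
  also have "census (insert 5 {1, 3, 4}) (2 + 1) (2 + 2) (2 + 3) = census (insert 5 {1, 3, 4}) 3 4 5"
    by simp
  also have "\<dots> = short_step (census {1, 3, 4} 1 3 4)"
    by (rule census_short_step) (auto simp: cube_adj_def)
  also have "census {1, 3, 4} 1 3 4 = triangle_census"
    by (rule census_triangle) (auto simp: cube_adj_def)
  finally show ?thesis .
qed

lemma tree_count_delete_third:
  "tree_count ({1..m + 6} - {3}) = (full_step ^^ m) ((short_step ^^ 2) triangle_census) XYZ"
proof -
  have "tree_count ({1..m + 6} - {3}) =
      (full_step ^^ m) (census (insert 6 (insert 5 {1, 2, 4})) (3 + 1) (3 + 2) (3 + 3)) XYZ"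
    by (rule tree_count_extend) auto
  also have "census (insert 6 (insert 5 {1, 2, 4})) (3 + 1) (3 + 2) (3 + 3) =
      census (insert 6 (insert 5 {1, 2, 4})) 4 5 6"
    by simp
  also have "\<dots> = short_step (census (insert 5 {1, 2, 4}) 2 4 5)"
    by (rule census_short_step) (auto simp: cube_adj_def)
  also have "census (insert 5 {1, 2, 4}) 2 4 5 = short_step (census {1, 2, 4} 1 2 4)"
    by (rule census_short_step) (auto simp: cube_adj_def)
  also have "census {1, 2, 4} 1 2 4 = triangle_census"
    by (rule census_triangle) (auto simp: cube_adj_def)
  finally show ?thesis by (simp add: numeral_2_eq_2)
qed

lemma tree_count_delete_inner:
  "tree_count ({1..k + l + 7} - {k + 4}) =
    (full_step ^^ l) ((short_step ^^ 3) ((full_step ^^ k) triangle_census)) XYZ"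
proof -
  let ?V = "insert (k + 7) (insert (k + 6) (insert (k + 5) {1..k + 3}))"
  have sums: "k + 4 + 1 = k + 5" "k + 4 + 2 = k + 6" "k + 4 + 3 = k + 7" by simp_all
  have "tree_count ({1..k + l + 7} - {k + 4}) =
      (full_step ^^ l) (census ?V (k + 4 + 1) (k + 4 + 2) (k + 4 + 3)) XYZ"
    by (rule tree_count_extend) auto
  then show ?thesis unfolding sums census_gap3 .
qed

lemma tree_count_delete_third_last:
  "tree_count ({1..m + 6} - {m + 4}) = (short_step ^^ 2) ((full_step ^^ m) triangle_census) XYZ"
proof -
  have V: "{1..m + 6} - {m + 4} = insert (m + 6) (insert (m + 5) {1..m + 3})" by auto
  show ?thesis unfolding V census_gap2[symmetric] by (rule tree_count_census) auto
qed

lemma tree_count_delete_second_last: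
  "tree_count ({1..m + 5} - {m + 4}) = short_step ((full_step ^^ m) triangle_census) XYZ"
proof -
  have V: "{1..m + 5} - {m + 4} = insert (m + 5) {1..m + 3}" by auto
  show ?thesis unfolding V census_gap1[symmetric] by (rule tree_count_census) auto
qed

lemma tree_count_delete_last:
  "tree_count ({1..m + 4} - {m + 4}) = (full_step ^^ m) triangle_census XYZ"
proof -
  have V: "{1..m + 4} - {m + 4} = {1..m + 3}" by auto
  show ?thesis unfolding V by (rule tree_count_path)
qed

section \<open>Counting leaves by deleting them\<close>

lemma add_leaf_in_trees:
  assumes v: "v \<in> V" "s \<in> V - {v}" "v \<notin> Field E" and E: "sym E"
  shows "add_vertex v {s} E \<in> trees G V \<longleftrightarrow>
    add_vertex v {s} E \<subseteq> G \<and> E \<in> trees E (V - {v})"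
proof -
  have reach: "(u, u') \<in> (add_vertex v {s} E)\<^sup>* \<longleftrightarrow>
      (if u' = v then (u, s) \<in> E\<^sup>* else (u, u') \<in> E\<^sup>*)" if "u \<noteq> v" for u u'
    using reach_add_vertex[OF v(3) E that, of u' "{s}"] by (auto intro: rtrancl_trans)
  have "(\<forall>u\<in>V. \<forall>u'\<in>V. (u, u') \<in> (add_vertex v {s} E)\<^sup>*) \<longleftrightarrow>
      (\<forall>u\<in>V - {v}. \<forall>u'\<in>V - {v}. (u, u') \<in> E\<^sup>*)" (is "?L \<longleftrightarrow> ?R")
  proof
    assume L: ?L
    show ?R
    proof (intro ballI)
      fix u u' assume "u \<in> V - {v}" "u' \<in> V - {v}"
      then show "(u, u') \<in> E\<^sup>*" using L reach[of u u'] by simp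
    qed
  next
    assume R: ?R
    show ?L
    proof (intro ballI)
      fix u u' assume u: "u \<in> V" "u' \<in> V"
      have 1: "(u, u') \<in> (add_vertex v {s} E)\<^sup>*" if "u \<noteq> v" "u \<in> V" "u' \<in> V" for u u'
        using reach[OF that(1), of u'] R that v(2) by auto
      show "(u, u') \<in> (add_vertex v {s} E)\<^sup>*"
        using 1[of u u'] 1[of u' u] u sym_rtrancl_iff[OF sym_add_vertex[OF E]]
        by (cases "u = v"; cases "u' = v") blast+
    qed
  qed
  moreover have "all_bridges (add_vertex v {s} E) \<longleftrightarrow> all_bridges E"
    using all_bridges_add_vertex[OF v(3) _ E, of "{s}"] v(2) by auto
  ultimately show ?thesis
    unfolding trees_def using E sym_add_vertex[OF E] by blast
qed

lemma card_trees_with_leaf: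
  assumes G: "sym G" "irrefl G" "G \<subseteq> V \<times> V" and v: "v \<in> V"
  shows "card {E \<in> trees G V. card (E `` {v}) = 1} =
    card (G `` {v}) * card (trees (G \<inter> (V - {v}) \<times> (V - {v})) (V - {v}))"
proof -
  let ?G = "G \<inter> (V - {v}) \<times> (V - {v})"
  let ?T = "trees ?G (V - {v})"
  have field: "v \<notin> Field E" if "E \<in> ?T" for E
    using that by (auto simp: trees_def Field_def)
  have nbr: "s \<in> V - {v}" "(s, v) \<in> G" if "s \<in> G `` {v}" for s
    using that G by (auto simp: irrefl_def sym_def)
  have "bij_betw (\<lambda>(s, E). add_vertex v {s} E) (G `` {v} \<times> ?T) {E \<in> trees G V. card (E `` {v}) = 1}"
    unfolding bij_betw_def
  proof
    show "inj_on (\<lambda>(s, E). add_vertex v {s} E) (G `` {v} \<times> ?T)"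
    proof (rule inj_onI)
      fix t t' assume t: "t \<in> G `` {v} \<times> ?T" "t' \<in> G `` {v} \<times> ?T"
        and "(\<lambda>(s, E). add_vertex v {s} E) t = (\<lambda>(s, E). add_vertex v {s} E) t'"
      then have "add_vertex v {fst t} (snd t) = add_vertex v {fst t'} (snd t')"
        by (simp add: case_prod_beta)
      moreover have "fst t \<in> G `` {v}" "fst t' \<in> G `` {v}" "snd t \<in> ?T" "snd t' \<in> ?T"
        using t by (simp_all add: mem_Times_iff)
      then have "v \<notin> Field (snd t)" "v \<notin> Field (snd t')" "v \<notin> {fst t}" "v \<notin> {fst t'}"
        using field nbr(1) by blast+
      ultimately have "{fst t} = {fst t'}" "snd t = snd t'" using add_vertex_inject by metis+
      then show "t = t'" by (simp add: prod_eq_iff)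
    qed
    show "(\<lambda>(s, E). add_vertex v {s} E) ` (G `` {v} \<times> ?T) = {E \<in> trees G V. card (E `` {v}) = 1}"
    proof (intro equalityI subsetI)
      fix E' assume "E' \<in> (\<lambda>(s, E). add_vertex v {s} E) ` (G `` {v} \<times> ?T)"
      then obtain s E where s: "s \<in> G `` {v}" and E: "E \<in> ?T" and E': "E' = add_vertex v {s} E" by auto
      have symE: "sym E" and sub: "E \<subseteq> G" and "E \<in> trees E (V - {v})"
        using E by (auto simp: trees_def)
      moreover have "add_vertex v {s} E \<subseteq> G" using sub s nbr(2)[OF s] by (auto simp: add_vertex_def)
      ultimately have "E' \<in> trees G V"
        unfolding E' using add_leaf_in_trees[OF v nbr(1)[OF s] field[OF E] symE, of G] by blast
      moreover have "E' `` {v} = {s}"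
        using field[OF E] nbr(1)[OF s] by (auto simp: E' add_vertex_def Field_def)
      ultimately show "E' \<in> {E \<in> trees G V. card (E `` {v}) = 1}" by simp
    next
      fix E' assume "E' \<in> {E \<in> trees G V. card (E `` {v}) = 1}"
      then obtain s where E': "E' \<in> trees G V" and s: "E' `` {v} = {s}"
        by (auto simp: card_1_singleton_iff)
      define E where "E = E' \<inter> (- {v}) \<times> (- {v})"
      have sub: "E' \<subseteq> G" and symE': "sym E'" using E' by (auto simp: trees_def)
      have sG: "s \<in> G `` {v}" using s sub by blast
      have "(v, v) \<notin> E'" using sub G(2) by (auto simp: irrefl_def)
      from add_vertex_delete[OF symE' this] have dec: "E' = add_vertex v {s} E" unfolding s E_def .
      have symE: "sym E" using symE' by (auto simp: E_def sym_def)
      have "v \<notin> Field E" by (auto simp: E_def Field_def)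
      from add_leaf_in_trees[OF v nbr(1)[OF sG] this symE, of G] E' dec
      have "E \<in> trees E (V - {v})" by simp
      moreover have "E \<subseteq> ?G" using sub G(3) by (auto simp: E_def)
      ultimately have "E \<in> ?T" by (auto simp: trees_def)
      then show "E' \<in> (\<lambda>(s, E). add_vertex v {s} E) ` (G `` {v} \<times> ?T)"
        using sG dec by (intro image_eqI[of _ _ "(s, E)"]) auto
    qed
  qed
  then have "card (G `` {v} \<times> ?T) = card {E \<in> trees G V. card (E `` {v}) = 1}"
    by (rule bij_betw_same_card)
  then show ?thesis by (simp add: card_cartesian_product)
qed

text \<open>
  Double counting of the pairs of a spanning tree and one of its leaves.
\<close>

lemma sum_leaves:
  assumes V: "finite V" and G: "sym G" "irrefl G" "G \<subseteq> V \<times> V"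
  shows "(\<Sum>E\<in>trees G V. card {v \<in> V. card (E `` {v}) = 1}) =
    (\<Sum>v\<in>V. card (G `` {v}) * card (trees (G \<inter> (V - {v}) \<times> (V - {v})) (V - {v})))"
proof -
  have "finite G" using G(3) finite_cartesian_product[OF V V] by (rule finite_subset)
  moreover have "trees G V \<subseteq> Pow G" unfolding trees_def by blast
  ultimately have fin: "finite (trees G V)" by (simp add: finite_subset)
  have "(\<Sum>E\<in>trees G V. card {v \<in> V. card (E `` {v}) = 1}) =
      (\<Sum>E\<in>trees G V. \<Sum>v\<in>V. if card (E `` {v}) = 1 then 1 else 0)"
    using V by (simp add: sum.If_cases Int_def)
  also have "\<dots> = (\<Sum>v\<in>V. \<Sum>E\<in>trees G V. if card (E `` {v}) = 1 then 1 else 0)"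
    by (rule sum.swap)
  also have "\<dots> = (\<Sum>v\<in>V. card {E \<in> trees G V. card (E `` {v}) = 1})"
    using fin by (simp add: sum.If_cases Int_def)
  finally show ?thesis using card_trees_with_leaf[OF G] by simp
qed

definition cube_degree :: "nat \<Rightarrow> nat \<Rightarrow> nat" where
  "cube_degree n v = card {u \<in> {1..n}. cube_adj v u}"

lemma sum_leaves_cube:
  "(\<Sum>E\<in>trees (cube {1..n}) {1..n}. card {v \<in> {1..n}. card (E `` {v}) = 1}) =
    (\<Sum>v\<in>{1..n}. cube_degree n v * tree_count ({1..n} - {v}))"
proof -
  have "cube {1..n} \<inter> ({1..n} - {v}) \<times> ({1..n} - {v}) = cube ({1..n} - {v})" for v
    by (auto simp: cube_def)
  moreover have "v \<in> {1..n} \<Longrightarrow> cube {1..n} `` {v} = {u \<in> {1..n}. cube_adj v u}" for v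
    by (auto simp: cube_def)
  moreover have "sym (cube {1..n})" "irrefl (cube {1..n})" "cube {1..n} \<subseteq> {1..n} \<times> {1..n}"
    by (auto simp: cube_def sym_def irrefl_def cube_adj_def)
  ultimately show ?thesis
    using sum_leaves[of "{1..n}" "cube {1..n}"] by (simp add: cube_degree_def tree_count_def)
qed

section \<open>The total number of leaves as a sum of transfer products\<close>

text \<open>
  In the smallest graph the middle vertex is near both ends, and its degree 4 fits neither end. This
  makes the case of five vertices an exception to the formula for the larger ones.
\<close>

lemma tree_count_delete_middle_of_5:
  "tree_count ({1..5} - {3}) = short_step triangle_census XYZ"
proof -
  have "{1..5} - {3::nat} = insert 5 {1, 2, 4}" by auto
  then have "tree_count ({1..5} - {3}) = census (insert 5 {1, 2, 4}) 2 4 5 XYZ"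
    by (metis tree_count_census empty_subsetI insertI1 insertI2 insert_subset)
  also have "census (insert 5 {1, 2, 4}) 2 4 5 = short_step (census {1, 2, 4} 1 2 4)"
    by (rule census_short_step) (auto simp: cube_adj_def)
  also have "census {1, 2, 4} 1 2 4 = triangle_census"
    by (rule census_triangle) (auto simp: cube_adj_def)
  finally show ?thesis .
qed

lemma cube_degree_eq:
  assumes "1 \<le> v" "v \<le> n"
  shows "cube_degree n v = min 3 (v - 1) + min 3 (n - v)"
proof -
  have nbrs: "{u \<in> {1..n}. cube_adj v u} = {max 1 (v - 3)..<v} \<union> {v<..min n (v + 3)}"
    using assms by (auto simp: cube_adj_def)
  have "cube_degree n v = card {max 1 (v - 3)..<v} + card {v<..min n (v + 3)}"
    unfolding cube_degree_def nbrs by (rule card_Un_disjoint) auto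
  also have "\<dots> = (v - max 1 (v - 3)) + (min n (v + 3) - v)"
    by (simp only: card_atLeastLessThan card_greaterThanAtMost)
  also have "v - max 1 (v - 3) = min 3 (v - 1)" using assms by linarith
  also have "min n (v + 3) - v = min 3 (n - v)" using assms by linarith
  finally show ?thesis .
qed

definition leaf_total :: "nat \<Rightarrow> nat" where
  "leaf_total n = (\<Sum>v\<in>{1..n}. cube_degree n v * tree_count ({1..n} - {v}))"

lemma leaf_total_5: "leaf_total 5 = 192"
proof -
  have full: "(full_step ^^ 1) triangle_census XYZ = (16 :: nat)" by simp
  have "tree_count ({1..5} - {1}) = 16"
    using tree_count_delete_first[of 1] unfolding full by (simp del: One_nat_def)
  moreover have "tree_count ({1..5} - {2}) = 8"
    using tree_count_delete_second[of 0] by (simp del: One_nat_def)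
  moreover have "tree_count ({1..5} - {3}) = 8"
    using tree_count_delete_middle_of_5 by (simp del: One_nat_def)
  moreover have "tree_count ({1..5} - {4}) = 8"
    using tree_count_delete_second_last[of 0] by (simp del: One_nat_def)
  moreover have "tree_count ({1..5} - {5}) = 16"
    using tree_count_delete_last[of 1] unfolding full by (simp del: One_nat_def)
  moreover have "{1..5::nat} = {1, 2, 3, 4, 5}" by auto
  then have "leaf_total 5 = (\<Sum>v\<in>{1, 2, 3, 4, 5}. cube_degree 5 v * tree_count ({1..5} - {v}))"
    unfolding leaf_total_def by (rule sum.cong) simp
  ultimately show ?thesis by (simp add: cube_degree_eq del: One_nat_def)
qed

text \<open>
  The weighted contribution, sorted by partitions, of all deleted vertices whose three successors
  have been passed, in the path with \<open>m + 6\<close> vertices. The initial value collects the first three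
  vertices, of degrees 3, 4 and 5; afterwards each step adds one inner vertex, of degree 6.
\<close>

primrec settled :: "nat \<Rightarrow> links \<Rightarrow> 'a::comm_semiring_1" where
  "settled 0 p = 3 * (full_step ^^ 2) triangle_census p + 4 * full_step (short_step triangle_census) p +
     5 * (short_step ^^ 2) triangle_census p"
| "settled (Suc m) p = full_step (settled m) p + 6 * (short_step ^^ 3) ((full_step ^^ m) triangle_census) p"

lemma full_step_add: "full_step (\<lambda>p. f p + g p) q = full_step f q + full_step g q"
  by (cases q) (simp_all add: algebra_simps)

lemma full_step_mult: "full_step (\<lambda>p. c * f p) q = c * full_step f q"
  by (cases q) (simp_all add: algebra_simps)

lemma short_step_mult: "short_step (\<lambda>p. c * f p) q = c * short_step f q"
  by (cases q) (simp_all add: algebra_simps)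

lemma full_step_sum: "full_step (\<lambda>p. \<Sum>k\<in>A. f k p) q = (\<Sum>k\<in>A. full_step (f k) q)"
  by (cases q) (simp_all add: sum.distrib sum_distrib_left)

lemma settled_eq:
  "(settled m p :: 'a::comm_semiring_1) = 3 * (full_step ^^ (m + 2)) triangle_census p +
     4 * (full_step ^^ (m + 1)) (short_step triangle_census) p +
     5 * (full_step ^^ m) ((short_step ^^ 2) triangle_census) p +
     6 * (\<Sum>k<m. (full_step ^^ (m - 1 - k)) ((short_step ^^ 3) ((full_step ^^ k) triangle_census)) p)"
proof (induction m arbitrary: p)
  case 0
  then show ?case by (simp add: numeral_2_eq_2)
next
  case (Suc m)
  have "full_step (\<lambda>q. \<Sum>k<m. (full_step ^^ (m - 1 - k)) ((short_step ^^ 3) ((full_step ^^ k) triangle_census)) q) p =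
      (\<Sum>k<m. (full_step ^^ (m - k)) ((short_step ^^ 3) ((full_step ^^ k) triangle_census)) p :: 'a)"
    unfolding full_step_sum
  proof (rule sum.cong)
    fix k assume "k \<in> {..<m}"
    then have "m - k = Suc (m - 1 - k)" by auto
    then show "full_step ((full_step ^^ (m - 1 - k)) ((short_step ^^ 3) ((full_step ^^ k) triangle_census))) p =
        (full_step ^^ (m - k)) ((short_step ^^ 3) ((full_step ^^ k) triangle_census)) p" by simp
  qed simp
  then show ?case
    unfolding settled.simps Suc.IH full_step_add full_step_mult
    by (simp add: algebra_simps)
qed

lemma sum_split_ends:
  fixes g :: "nat \<Rightarrow> 'a::comm_monoid_add"
  shows
  "(\<Sum>v = 1..m + 6. g v) =
    g 1 + g 2 + g 3 + (\<Sum>k<m. g (k + 4)) + g (m + 4) + g (m + 5) + g (m + 6)"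
proof -
  have "(\<Sum>v = 1..m + 3. g v) = g 1 + g 2 + g 3 + (\<Sum>k<m. g (k + 4))"
  proof (induction m)
    case 0
    then show ?case by (simp add: eval_nat_numeral add.assoc)
  next
    case (Suc m)
    have "(\<Sum>v = 1..Suc m + 3. g v) = (\<Sum>v = 1..m + 3. g v) + g (m + 4)"
      by (simp add: eval_nat_numeral)
    then show ?case using Suc.IH by (simp add: add.assoc)
  qed
  moreover have "(\<Sum>v = 1..m + 6. g v) = (\<Sum>v = 1..m + 3. g v) + g (m + 4) + g (m + 5) + g (m + 6)"
    by (simp add: eval_nat_numeral)
  ultimately show ?thesis by simp
qed

text \<open>
  The last three vertices of the path are the ones that are not yet settled.
\<close>

lemma leaf_total_ge_6:
  "leaf_total (m + 6) = settled m XYZ + 5 * (short_step ^^ 2) ((full_step ^^ m) triangle_census) XYZ +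
     4 * short_step ((full_step ^^ (m + 1)) triangle_census) XYZ +
     3 * (full_step ^^ (m + 2)) triangle_census XYZ"
proof -
  let ?n = "m + 6"
  let ?g = "\<lambda>v. cube_degree ?n v * tree_count ({1..?n} - {v})"
  have sums: "m + 2 + 4 = ?n" "m + 1 + 5 = ?n" "m + 2 + 4 = m + 6" "m + 1 + 4 = m + 5" by simp_all
  have "?g 1 = 3 * (full_step ^^ (m + 2)) triangle_census XYZ"
    using tree_count_delete_first[of "m + 2"] unfolding sums by (simp add: cube_degree_eq)
  moreover have "?g 2 = 4 * (full_step ^^ (m + 1)) (short_step triangle_census) XYZ"
    using tree_count_delete_second[of "m + 1"] unfolding sums by (simp add: cube_degree_eq)
  moreover have "?g 3 = 5 * (full_step ^^ m) ((short_step ^^ 2) triangle_census) XYZ"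
    using tree_count_delete_third[of m] by (simp add: cube_degree_eq)
  moreover have "(\<Sum>k<m. ?g (k + 4)) =
      6 * (\<Sum>k<m. (full_step ^^ (m - 1 - k)) ((short_step ^^ 3) ((full_step ^^ k) triangle_census)) XYZ)"
    unfolding sum_distrib_left
  proof (rule sum.cong)
    fix k assume "k \<in> {..<m}"
    then have k: "k + (m - 1 - k) + 7 = ?n" "k + 6 < ?n" by auto
    have "cube_degree ?n (k + 4) = 6" using k(2) by (subst cube_degree_eq) auto
    then show "?g (k + 4) =
        6 * (full_step ^^ (m - 1 - k)) ((short_step ^^ 3) ((full_step ^^ k) triangle_census)) XYZ"
      using tree_count_delete_inner[of k "m - 1 - k"] unfolding k(1) by simp
  qed simp
  moreover have "?g (m + 4) = 5 * (short_step ^^ 2) ((full_step ^^ m) triangle_census) XYZ"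
    using tree_count_delete_third_last[of m] by (simp add: cube_degree_eq)
  moreover have "?g (m + 5) = 4 * short_step ((full_step ^^ (m + 1)) triangle_census) XYZ"
    using tree_count_delete_second_last[of "m + 1"] unfolding sums by (simp add: cube_degree_eq)
  moreover have "?g (m + 6) = 3 * (full_step ^^ (m + 2)) triangle_census XYZ"
    using tree_count_delete_last[of "m + 2"] unfolding sums by (simp add: cube_degree_eq)
  ultimately show ?thesis
    unfolding leaf_total_def sum_split_ends settled_eq by presburger
qed

section \<open>Generating functions\<close>

lemma full_step_diff:
  "full_step (\<lambda>p. f p - g p :: 'a::comm_ring_1) q = full_step f q - full_step g q"
  by (cases q) (simp_all add: algebra_simps)

lemma of_nat_full_step: "of_nat (full_step f p) = full_step (\<lambda>q. of_nat (f q)) p"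
  by (cases p) simp_all

lemma of_nat_short_step: "of_nat (short_step f p) = short_step (\<lambda>q. of_nat (f q)) p"
  by (cases p) simp_all

lemma fps_nth_numeral_times: "fps_nth (numeral k * f) n = numeral k * fps_nth f n"
  by (simp add: numeral_fps_const)

lemma fps_nth_numeral_Suc: "fps_nth (numeral k) (Suc n) = 0"
  by (simp add: numeral_fps_const)

lemma fps_nth_full_step: "fps_nth (full_step F p) n = full_step (\<lambda>q. fps_nth (F q) n) p"
  by (cases p) (simp_all add: fps_nth_numeral_times)

lemma fps_nth_short_step: "fps_nth (short_step F p) n = short_step (\<lambda>q. fps_nth (F q) n) p"
  by (cases p) (simp_all add: fps_nth_numeral_times)

text \<open>
  The factor \<open>X\<close> makes each coefficient depend on the previous ones only.
\<close>

lemma full_step_fps_unique: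
  fixes Z :: "links \<Rightarrow> 'a::comm_ring_1 fps"
  assumes "\<And>p. Z p = fps_X * full_step Z p"
  shows "Z p = 0"
proof (rule fps_ext)
  have "fps_nth (Z p) n = 0" for n p
  proof (induction n arbitrary: p)
    case 0
    then show ?case by (subst assms) simp
  next
    case (Suc n)
    have "fps_nth (Z p) (Suc n) = full_step (\<lambda>q. fps_nth (Z q) n) p"
      by (subst assms) (simp add: fps_nth_full_step)
    then show ?case using Suc.IH by (cases p) simp_all
  qed
  then show "fps_nth (Z p) n = fps_nth 0 n" for n by simp
qed

definition path_series :: "links \<Rightarrow> rat fps" where
  "path_series p = Abs_fps (\<lambda>m. of_nat ((full_step ^^ m) triangle_census p))"

definition settled_series :: "links \<Rightarrow> rat fps" where
  "settled_series p = Abs_fps (\<lambda>m. of_nat (settled m p))"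

lemma path_series_eq: "path_series p = triangle_census p + fps_X * full_step path_series p"
proof (rule fps_ext)
  fix n
  show "fps_nth (path_series p) n = fps_nth (triangle_census p + fps_X * full_step path_series p) n"
  proof (cases n)
    case 0
    then show ?thesis by (cases p) (simp_all add: path_series_def)
  next
    case (Suc m)
    have "fps_nth (triangle_census p :: rat fps) (Suc m) = 0"
      by (cases p) (simp_all add: fps_nth_numeral_Suc)
    then show ?thesis
      by (simp add: Suc fps_nth_full_step) (simp add: path_series_def of_nat_full_step)
  qed
qed

lemma settled_series_eq:
  "settled_series p = settled 0 p + fps_X * (full_step settled_series p + 6 * (short_step ^^ 3) path_series p)"
proof (rule fps_ext)
  fix n
  show "fps_nth (settled_series p) n =
    fps_nth (settled 0 p + fps_X * (full_step settled_series p + 6 * (short_step ^^ 3) path_series p)) n"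
  proof (cases n)
    case 0
    then show ?thesis by (cases p) (simp_all add: settled_series_def numeral_2_eq_2 fps_nth_numeral_times)
  next
    case (Suc m)
    have "fps_nth (settled 0 p :: rat fps) (Suc m) = 0"
      by (cases p) (simp_all add: numeral_2_eq_2 fps_nth_numeral_times fps_nth_numeral_Suc)
    then show ?thesis
      by (simp add: Suc fps_nth_full_step fps_nth_short_step fps_nth_numeral_times numeral_3_eq_3 del: settled.simps(1))
         (simp add: path_series_def settled_series_def of_nat_full_step of_nat_short_step numeral_3_eq_3)
  qed
qed

text \<open>
  The characteristic polynomial of \<open>full_step\<close>, which is also \<open>- det (1 - X A)\<close> because its
  coefficients are antisymmetric.
\<close>

definition char_poly :: "rat fps" where
  "char_poly = (fps_X - 1) * (fps_X ^ 4 - 4 * fps_X ^ 3 - fps_X ^ 2 - 4 * fps_X + 1)"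

text \<open>
  The products of \<open>char_poly\<close> with \<open>path_series\<close> and of its square with \<open>settled_series\<close>, computed from
  the initial coefficients of these series. They are polynomials by Cramer's rule, which bounds
  their degrees; that they are correct is the content of \<open>path_num_eq\<close> and \<open>settled_num_eq\<close>.
\<close>

fun path_num :: "links \<Rightarrow> rat fps" where
  "path_num Sep = 3 * fps_X ^ 3 - fps_X ^ 4 + fps_X ^ 2 + 2 * fps_X - 1"
| "path_num XY = fps_X ^ 3 - 3 * fps_X ^ 2 + fps_X - 1"
| "path_num YZ = 5 * fps_X ^ 3 - fps_X ^ 4 + 2 * fps_X ^ 2 + fps_X - 1"
| "path_num XZ = 2 * fps_X ^ 2 + fps_X - 1"
| "path_num XYZ = - 4 * fps_X ^ 2 - fps_X - 3"

fun settled_num :: "links \<Rightarrow> rat fps" where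
  "settled_num Sep = - 42 * fps_X ^ 9 + 362 * fps_X ^ 8 - 806 * fps_X ^ 7 + 342 * fps_X ^ 6
     - 1186 * fps_X ^ 5 + 1130 * fps_X ^ 4 - 616 * fps_X ^ 3 + 600 * fps_X ^ 2 - 446 * fps_X + 86"
| "settled_num XY = - 24 * fps_X ^ 9 + 262 * fps_X ^ 8 - 924 * fps_X ^ 7 + 1240 * fps_X ^ 6
     - 1272 * fps_X ^ 5 + 1848 * fps_X ^ 4 - 1170 * fps_X ^ 3 + 866 * fps_X ^ 2 - 678 * fps_X + 140"
| "settled_num YZ = - 60 * fps_X ^ 9 + 552 * fps_X ^ 8 - 1280 * fps_X ^ 7 + 304 * fps_X ^ 6
     - 1450 * fps_X ^ 5 + 1496 * fps_X ^ 4 - 670 * fps_X ^ 3 + 674 * fps_X ^ 2 - 536 * fps_X + 106"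
| "settled_num XZ = - 20 * fps_X ^ 9 + 182 * fps_X ^ 8 - 430 * fps_X ^ 7 + 246 * fps_X ^ 6
     - 1018 * fps_X ^ 5 + 1136 * fps_X ^ 4 - 614 * fps_X ^ 3 + 666 * fps_X ^ 2 - 546 * fps_X + 110"
| "settled_num XYZ = - 80 * fps_X ^ 9 + 806 * fps_X ^ 8 - 2570 * fps_X ^ 7 + 3062 * fps_X ^ 6
     - 3546 * fps_X ^ 5 + 5880 * fps_X ^ 4 - 3238 * fps_X ^ 3 + 2650 * fps_X ^ 2 - 2302 * fps_X + 490"

lemma path_num_eq: "path_num p = char_poly * triangle_census p + fps_X * full_step path_num p"
  unfolding char_poly_def by (cases p) (simp_all add: algebra_simps eval_nat_numeral)

lemma settled_num_eq:
  "settled_num p = char_poly ^ 2 * settled 0 p +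
     fps_X * (full_step settled_num p + 6 * (char_poly * (short_step ^^ 3) path_num p))"
  unfolding char_poly_def by (cases p) (simp_all add: algebra_simps eval_nat_numeral)

lemma short_step_funpow_mult:
  "(short_step ^^ k) (\<lambda>p. c * f p) q = c * (short_step ^^ k) f q"
proof (induction k arbitrary: q)
  case (Suc k)
  then have "(short_step ^^ k) (\<lambda>p. c * f p) = (\<lambda>q. c * (short_step ^^ k) f q)" by auto
  then show ?case by (simp add: short_step_mult)
qed simp

text \<open>
  The difference of the two sides solves the homogeneous system.
\<close>

lemma path_series_closed: "char_poly * path_series p = path_num p"
proof -
  define Z where "Z p = char_poly * path_series p - path_num p" for p
  have "Z p = fps_X * full_step Z p" for p
  proof -
    have step: "full_step Z p = char_poly * full_step path_series p - full_step path_num p"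
      unfolding Z_def full_step_diff full_step_mult ..
    have "Z p = char_poly * triangle_census p + fps_X * (char_poly * full_step path_series p) - path_num p"
      unfolding Z_def by (subst path_series_eq) (simp add: algebra_simps)
    then show ?thesis
      unfolding step by (subst (asm) path_num_eq) (simp add: algebra_simps)
  qed
  then have "Z p = 0" by (rule full_step_fps_unique)
  then show ?thesis by (simp add: Z_def)
qed

lemma settled_series_closed: "char_poly ^ 2 * settled_series p = settled_num p"
proof -
  define Z where "Z p = char_poly ^ 2 * settled_series p - settled_num p" for p
  have "Z p = fps_X * full_step Z p" for p
  proof -
    have step: "full_step Z p = char_poly ^ 2 * full_step settled_series p - full_step settled_num p"
      unfolding Z_def full_step_diff full_step_mult ..
    have "char_poly * (short_step ^^ 3) path_series p = (short_step ^^ 3) path_num p"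
      unfolding short_step_funpow_mult[symmetric] path_series_closed ..
    then have inflow: "char_poly ^ 2 * (short_step ^^ 3) path_series p = char_poly * (short_step ^^ 3) path_num p"
      by (simp add: power2_eq_square mult.assoc)
    have "Z p = char_poly ^ 2 * settled 0 p + fps_X * (char_poly ^ 2 * full_step settled_series p +
        6 * (char_poly ^ 2 * (short_step ^^ 3) path_series p)) - settled_num p"
      unfolding Z_def by (subst settled_series_eq) (simp add: algebra_simps del: settled.simps)
    then show ?thesis
      unfolding inflow step by (subst (asm) settled_num_eq) (simp add: algebra_simps del: settled.simps)
  qed
  then have "Z p = 0" by (rule full_step_fps_unique)
  then show ?thesis by (simp add: Z_def)
qed

lemma leaf_total_series:
  "Abs_fps (\<lambda>m. of_nat (leaf_total (m + 5))) = 192 + fps_X * (settled_series XYZ +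
     5 * (short_step ^^ 2) path_series XYZ + 4 * short_step (full_step path_series) XYZ +
     3 * (full_step ^^ 2) path_series XYZ)"
proof (rule fps_ext)
  fix n
  show "fps_nth (Abs_fps (\<lambda>m. of_nat (leaf_total (m + 5)))) n = fps_nth (192 + fps_X * (settled_series XYZ +
     5 * (short_step ^^ 2) path_series XYZ + 4 * short_step (full_step path_series) XYZ +
     3 * (full_step ^^ 2) path_series XYZ)) n"
  proof (cases n)
    case 0
    then show ?thesis by (simp add: leaf_total_5)
  next
    case (Suc m)
    have "m + 6 = Suc m + 5" by simp
    then have "leaf_total (Suc m + 5) = settled m XYZ +
        5 * (short_step ^^ 2) ((full_step ^^ m) triangle_census) XYZ +
        4 * short_step ((full_step ^^ (m + 1)) triangle_census) XYZ +
        3 * (full_step ^^ (m + 2)) triangle_census XYZ"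
      using leaf_total_ge_6[of m] by metis
    then show ?thesis
      by (simp add: Suc fps_nth_numeral_times fps_nth_numeral_Suc fps_nth_full_step fps_nth_short_step
          numeral_2_eq_2 del: full_step.simps short_step.simps)
         (simp add: path_series_def settled_series_def of_nat_full_step of_nat_short_step
          del: full_step.simps short_step.simps)
  qed
qed

theorem leaf_total_generating_function:
  "Abs_fps (\<lambda>m. of_nat (leaf_total (m + 5)) :: rat) * char_poly ^ 2 =
    2 * (16 * fps_X ^ 10 - 154 * fps_X ^ 9 + 403 * fps_X ^ 8 - 340 * fps_X ^ 7
         + 963 * fps_X ^ 6 - 768 * fps_X ^ 5 + 1109 * fps_X ^ 4 - 788 * fps_X ^ 3
         + 509 * fps_X ^ 2 - 470 * fps_X + 96)"
proof -
  have path: "(\<lambda>p. char_poly * path_series p) = path_num"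
    by (rule ext) (rule path_series_closed)
  have 1: "char_poly * (short_step ^^ 2) path_series XYZ = (short_step ^^ 2) path_num XYZ"
    unfolding short_step_funpow_mult[symmetric] path ..
  have 2: "char_poly * short_step (full_step path_series) XYZ = short_step (full_step path_num) XYZ"
    unfolding short_step_mult[symmetric] full_step_mult[symmetric] path ..
  have 3: "char_poly * (full_step ^^ 2) path_series XYZ = (full_step ^^ 2) path_num XYZ"
    by (simp only: numeral_2_eq_2 funpow.simps o_apply id_apply full_step_mult[symmetric] path)
  have "Abs_fps (\<lambda>m. of_nat (leaf_total (m + 5)) :: rat) * char_poly ^ 2 =
      192 * char_poly ^ 2 + fps_X * (char_poly ^ 2 * settled_series XYZ + char_poly *
        (5 * (char_poly * (short_step ^^ 2) path_series XYZ) +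
         4 * (char_poly * short_step (full_step path_series) XYZ) +
         3 * (char_poly * (full_step ^^ 2) path_series XYZ)))"
    unfolding leaf_total_series by (simp only: power2_eq_square) (simp only: algebra_simps)
  also have "\<dots> = 192 * char_poly ^ 2 + fps_X * (settled_num XYZ + char_poly *
        (5 * (short_step ^^ 2) path_num XYZ + 4 * short_step (full_step path_num) XYZ +
         3 * (full_step ^^ 2) path_num XYZ))"
    unfolding 1 2 3 settled_series_closed ..
  also have "\<dots> = 2 * (16 * fps_X ^ 10 - 154 * fps_X ^ 9 + 403 * fps_X ^ 8 - 340 * fps_X ^ 7
         + 963 * fps_X ^ 6 - 768 * fps_X ^ 5 + 1109 * fps_X ^ 4 - 788 * fps_X ^ 3
         + 509 * fps_X ^ 2 - 470 * fps_X + 96)"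
    unfolding char_poly_def by (simp add: algebra_simps eval_nat_numeral)
  finally show ?thesis .
qed

section \<open>Trees and powers in terms of walks\<close>

lemma awalk_with_proj_iff:
  "pre_digraph.awalk (with_proj T) u p v \<longleftrightarrow> u \<in> pverts T \<and> set p \<subseteq> parcs T \<and> pcas u p v"
  by (simp add: pre_digraph.awalk_def cas_with_proj_eq)

lemma walk_reaches: "pcas u p v \<Longrightarrow> set p \<subseteq> E \<Longrightarrow> (u, v) \<in> E\<^sup>*"
  by (induction p arbitrary: u) (auto intro: converse_rtrancl_into_rtrancl)

lemma reaches_walk:
  assumes "(u, v) \<in> E\<^sup>*"
  shows "\<exists>p. pcas u p v \<and> set p \<subseteq> E"
  using assms
proof (induction rule: converse_rtrancl_induct)
  case base
  have "pcas v [] v" by simp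
  then show ?case by fastforce
next
  case (step y z)
  then obtain p where "pcas z p v" "set p \<subseteq> E" by blast
  then have "pcas y ((y, z) # p) v" "set ((y, z) # p) \<subseteq> E" using step.hyps by auto
  then show ?case by blast
qed

lemma reaches_path:
  assumes "(u, v) \<in> E\<^sup>*" "E \<subseteq> V \<times> V" "u \<in> V"
  obtains p where "pcas u p v" "set p \<subseteq> E" "distinct (pawalk_verts u p)"
proof -
  let ?T = "\<lparr>pverts = V, parcs = E\<rparr>"
  interpret wf_digraph "with_proj ?T"
    by unfold_locales (use assms(2) in auto)
  obtain p where "pcas u p v" "set p \<subseteq> E" using reaches_walk[OF assms(1)] by blast
  then have "awalk u p v" using assms(3) by (simp add: awalk_with_proj_iff)
  then have "apath u (awalk_to_apath p) v" by (rule apath_awalk_to_apath)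
  then show thesis
    using that[of "awalk_to_apath p"]
    by (simp add: apath_def awalk_with_proj_iff awalk_verts_with_proj_eq)
qed

lemma pawalk_verts_tails: "pcas u p v \<Longrightarrow> pawalk_verts u p = map fst p @ [v]"
  by (induction p arbitrary: u) auto

lemma pawalk_verts_heads: "pcas u p v \<Longrightarrow> pawalk_verts u p = u # map snd p"
  by (induction p arbitrary: u) (auto split: list.splits)

text \<open>
  An edge that is not a bridge closes a path around it to a cycle; this path has length at least two
  because the edge itself is excluded. Conversely, the rest of a cycle through \<open>uv\<close> is a path from \<open>v\<close>
  to \<open>u\<close>. It avoids \<open>uv\<close> because it does not return to \<open>v\<close>, and it could use the
  arc \<open>vu\<close> only as its single arc, which length three rules out.
\<close>

lemma acyclic_iff_all_bridges:
  assumes "pair_graph T"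
  shows "\<not> (\<exists>p. pre_digraph.cycle (with_proj T) p \<and> 3 \<le> length p) \<longleftrightarrow> all_bridges (parcs T)"
proof -
  interpret pair_graph T by fact
  let ?E = "parcs T"
  have wf: "?E \<subseteq> pverts T \<times> pverts T" by (auto dest: arc_fst_in_verts arc_snd_in_verts)
  have loop: "(u, v) \<in> ?E \<Longrightarrow> u \<noteq> v" for u v using pair_no_loops by fastforce
  have cyc: "pre_digraph.cycle (with_proj T) p \<longleftrightarrow>
      (\<exists>u. u \<in> pverts T \<and> set p \<subseteq> ?E \<and> pcas u p u \<and> distinct (tl (pawalk_verts u p)) \<and> p \<noteq> [])" for p
    by (auto simp: pre_digraph.cycle_def awalk_with_proj_iff awalk_verts_with_proj_eq)
  show ?thesis
  proof (intro iffI notI)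
    assume acyc: "\<not> (\<exists>p. pre_digraph.cycle (with_proj T) p \<and> 3 \<le> length p)"
    show "all_bridges ?E"
      unfolding all_bridges_def
    proof safe
      fix u v assume uv: "(u, v) \<in> ?E" "(u, v) \<in> (?E - {(u, v), (v, u)})\<^sup>*"
      have V: "u \<in> pverts T" "v \<in> pverts T" using uv wf by auto
      obtain p where p: "pcas u p v" "set p \<subseteq> ?E - {(u, v), (v, u)}" "distinct (pawalk_verts u p)"
        using reaches_path[OF uv(2) _ V(1)] wf by blast
      have "2 \<le> length p"
      proof (rule ccontr)
        assume "\<not> 2 \<le> length p"
        then consider "p = []" | e where "p = [e]" by (cases p; cases "tl p") auto
        then show False using p loop[OF uv(1)] by cases (auto simp: prod_eq_iff)
      qed
      moreover have "pre_digraph.cycle (with_proj T) ((v, u) # p)"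
        unfolding cyc using p V arcs_symmetric[OF uv(1)] by auto
      ultimately show False using acyc by fastforce
    qed
  next
    assume br: "all_bridges ?E" and "\<exists>p. pre_digraph.cycle (with_proj T) p \<and> 3 \<le> length p"
    then obtain p u where p: "set p \<subseteq> ?E" "pcas u p u" "distinct (tl (pawalk_verts u p))" "3 \<le> length p"
      unfolding cyc by blast
    obtain e f q where efq: "p = e # f # q" and q: "q \<noteq> []"
      using p(4) by (auto simp: numeral_3_eq_3 Suc_le_length_iff)
    define v c where "v = snd e" and "c = snd f"
    have pq: "p = (u, v) # (v, c) # q"
      using p(2) by (auto simp: efq v_def c_def prod_eq_iff)
    have cas: "pcas v ((v, c) # q) u" and dist: "distinct (pawalk_verts v ((v, c) # q))"
      using p pq by auto
    have "v \<notin> snd ` set ((v, c) # q)" using dist unfolding pawalk_verts_heads[OF cas] by simp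
    then have 1: "(u, v) \<notin> set ((v, c) # q)" by force
    have 2: "(v, u) \<notin> set ((v, c) # q)"
    proof
      assume "(v, u) \<in> set ((v, c) # q)"
      moreover have "v \<notin> fst ` set q"
        using dist pawalk_verts_tails[OF cas] by auto
      ultimately have "c = u" by force
      then have "u \<in> set (map fst q)" using cas q by (cases q) auto
      then show False using dist pawalk_verts_tails[OF cas] by auto
    qed
    have "(v, u) \<in> (?E - {(v, u), (u, v)})\<^sup>*"
      using cas by (rule walk_reaches) (use p(1) pq 1 2 in auto)
    moreover have "(v, u) \<in> ?E" using arcs_symmetric p(1) pq by auto
    ultimately show False using br unfolding all_bridges_def by blast
  qed
qed

lemma connected_iff_reach:
  assumes "pair_graph T"
  shows "Digraph_Component.connected (with_proj T) \<longleftrightarrow>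
    pverts T \<noteq> {} \<and> (\<forall>u\<in>pverts T. \<forall>v\<in>pverts T. (u, v) \<in> (parcs T)\<^sup>*)"
proof -
  interpret pair_graph T by fact
  have "u \<rightarrow>\<^sup>*\<^bsub>with_proj T\<^esub> v \<longleftrightarrow> (u, v) \<in> (parcs T)\<^sup>*" if "u \<in> pverts T" for u v
  proof
    assume "u \<rightarrow>\<^sup>*\<^bsub>with_proj T\<^esub> v"
    then obtain p where "pcas u p v" "set p \<subseteq> parcs T"
      unfolding reachable_awalk awalk_with_proj_iff by blast
    then show "(u, v) \<in> (parcs T)\<^sup>*" by (rule walk_reaches)
  next
    assume "(u, v) \<in> (parcs T)\<^sup>*"
    from reaches_walk[OF this] that show "u \<rightarrow>\<^sup>*\<^bsub>with_proj T\<^esub> v"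
      unfolding reachable_awalk awalk_with_proj_iff by blast
  qed
  then show ?thesis
    unfolding Digraph_Component.connected_def strongly_connected_def
    using reachable_mk_symmetric_eq[OF sym_arcs] by (auto simp: mk_symmetric_def)
qed

lemma pair_graph_iff:
  "pair_graph \<lparr>pverts = V, parcs = E\<rparr> \<longleftrightarrow>
    finite V \<and> finite E \<and> E \<subseteq> V \<times> V \<and> irrefl E \<and> sym E" (is "?L \<longleftrightarrow> ?R")
proof
  assume ?L
  then interpret pair_graph "\<lparr>pverts = V, parcs = E\<rparr>" .
  have "E \<subseteq> V \<times> V" using arc_fst_in_verts arc_snd_in_verts by force
  moreover have "irrefl E" using pair_no_loops by (force simp: irrefl_def)
  moreover have "sym E" using arcs_symmetric by (auto intro: symI)
  ultimately show ?R using pair_finite_verts pair_finite_arcs by simp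
next
  assume R: ?R
  then show ?L by unfold_locales (auto simp: irrefl_def symmetric_def)
qed

lemma spanning_trees_eq_trees:
  assumes G: "pair_graph \<lparr>pverts = V, parcs = E\<rparr>" and V: "V \<noteq> {}"
  shows "spanning_trees \<lparr>pverts = V, parcs = E\<rparr> = (\<lambda>F. \<lparr>pverts = V, parcs = F\<rparr>) ` trees E V"
proof -
  have fin: "finite V" "finite E" "E \<subseteq> V \<times> V" "irrefl E" using G by (auto simp: pair_graph_iff)
  have "\<lparr>pverts = W, parcs = F\<rparr> \<in> spanning_trees \<lparr>pverts = V, parcs = E\<rparr> \<longleftrightarrow> W = V \<and> F \<in> trees E V"
    for W F
  proof -
    have "spanning (with_proj \<lparr>pverts = W, parcs = F\<rparr>) (with_proj \<lparr>pverts = V, parcs = E\<rparr>) \<longleftrightarrow>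
        W = V \<and> F \<subseteq> E"
    proof -
      have "wf_digraph (with_proj \<lparr>pverts = V, parcs = F'\<rparr>)" if "F' \<subseteq> E" for F'
        using that fin(3) by unfold_locales auto
      then show ?thesis by (auto simp: spanning_def subgraph_def compatible_def)
    qed
    moreover have "pair_graph \<lparr>pverts = V, parcs = F\<rparr> \<longleftrightarrow> sym F" if "F \<subseteq> E"
      using that fin by (auto simp: pair_graph_iff irrefl_def intro: finite_subset)
    moreover have "graph_tree \<lparr>pverts = V, parcs = F\<rparr> \<longleftrightarrow> pair_graph \<lparr>pverts = V, parcs = F\<rparr> \<and>
        (\<forall>u\<in>V. \<forall>v\<in>V. (u, v) \<in> F\<^sup>*) \<and> all_bridges F"
      unfolding graph_tree_def
      using V acyclic_iff_all_bridges[of "\<lparr>pverts = V, parcs = F\<rparr>"]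
        connected_iff_reach[of "\<lparr>pverts = V, parcs = F\<rparr>"] by auto
    ultimately show ?thesis
      unfolding spanning_trees_def trees_def by blast
  qed
  then have "T \<in> spanning_trees \<lparr>pverts = V, parcs = E\<rparr> \<longleftrightarrow> pverts T = V \<and> parcs T \<in> trees E V" for T
    by (cases T) simp
  then show ?thesis
    by (auto intro!: image_eqI[where x = "parcs _"])
qed

lemma card_leaves:
  "card (leaves \<lparr>pverts = V, parcs = E\<rparr>) = card {v \<in> V. card (E `` {v}) = 1}"
proof -
  have "out_arcs (with_proj \<lparr>pverts = V, parcs = E\<rparr>) v = Pair v ` (E `` {v})" for v
    by (auto simp: out_arcs_def)
  then have "out_degree (with_proj \<lparr>pverts = V, parcs = E\<rparr>) v = card (E `` {v})" for v
    by (simp add: out_degree_def card_image inj_on_def)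
  then show ?thesis by (simp add: leaves_def)
qed

lemma path_walk_length:
  "pcas u p v \<Longrightarrow> set p \<subseteq> parcs (path_graph n) \<Longrightarrow> (u - v) + (v - u) \<le> length p"
proof (induction p arbitrary: u)
  case (Cons e p)
  then have "fst e = u" "snd e = Suc u \<or> u = Suc (snd e)" by (auto simp: path_graph_def)
  moreover have "(snd e - v) + (v - snd e) \<le> length p" using Cons by auto
  ultimately show ?case by auto
qed simp

lemma path_walk_exists:
  "u \<in> {1..n} \<Longrightarrow> v \<in> {1..n} \<Longrightarrow>
    \<exists>p. pcas u p v \<and> set p \<subseteq> parcs (path_graph n) \<and> length p = (u - v) + (v - u)"
proof (induction "(u - v) + (v - u)" arbitrary: u)
  case 0
  then have "pcas u [] v" by simp
  then show ?case using 0 by fastforce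
next
  case (Suc d)
  define w where "w = (if u < v then u + 1 else u - 1)"
  have w: "w \<in> {1..n}" "d = (w - v) + (v - w)" "(u, w) \<in> parcs (path_graph n)"
    using Suc.hyps(2) Suc.prems by (auto simp: w_def path_graph_def split: if_splits)
  then obtain p where "pcas w p v" "set p \<subseteq> parcs (path_graph n)" "length p = d"
    using Suc.hyps(1)[OF w(2,1) Suc.prems(2)] by auto
  then have "pcas u ((u, w) # p) v \<and> set ((u, w) # p) \<subseteq> parcs (path_graph n) \<and>
      length ((u, w) # p) = (u - v) + (v - u)"
    using w Suc.hyps(2) by simp
  then show ?case by blast
qed

text \<open>
  Each arc of the path changes the difference to \<open>v\<close> by one, and some arc decreases it. The
  truncated differences add up to the absolute value.
\<close>

lemma graph_dist_path_graph:
  assumes "u \<in> {1..n}" "v \<in> {1..n}"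
  shows "graph_dist (path_graph n) u v = ereal (real ((u - v) + (v - u)))"
proof -
  interpret pair_graph "path_graph n" by (rule pair_graph_path_graph)
  have V: "pverts (path_graph n) = {1..n}" by (simp add: path_graph_def)
  have cost: "awalk_cost (\<lambda>_. 1) p = real (length p)" for p :: "(nat \<times> nat) list"
    by (induction p) auto
  show ?thesis
    unfolding graph_dist_def \<mu>_def cost
  proof (rule INF_eqI)
    fix p assume "p \<in> {p. pre_digraph.awalk (with_proj (path_graph n)) u p v}"
    then show "ereal (real ((u - v) + (v - u))) \<le> ereal (real (length p))"
      using path_walk_length[of u p v n] by (simp add: awalk_with_proj_iff)
  next
    fix y assume y: "\<And>p. p \<in> {p. pre_digraph.awalk (with_proj (path_graph n)) u p v} \<Longrightarrow>
      y \<le> ereal (real (length p))"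
    obtain p where "pcas u p v" "set p \<subseteq> parcs (path_graph n)" "length p = (u - v) + (v - u)"
      using path_walk_exists[OF assms] by blast
    then show "y \<le> ereal (real ((u - v) + (v - u)))"
      using y[of p] assms by (simp add: awalk_with_proj_iff V)
  qed
qed

lemma graph_power_path_graph: "graph_power (path_graph n) 3 = \<lparr>pverts = {1..n}, parcs = cube {1..n}\<rparr>"
proof -
  have "1 \<le> graph_dist (path_graph n) u v \<and> graph_dist (path_graph n) u v \<le> ereal (real 3) \<longleftrightarrow> cube_adj u v"
    if "u \<in> {1..n}" "v \<in> {1..n}" for u v
    unfolding graph_dist_path_graph[OF that] one_ereal_def ereal_less_eq(3) cube_adj_def by linarith
  then show ?thesis
    unfolding graph_power_def by (auto simp: path_graph_def cube_def)
qed

lemma total_leaves_path_cube: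
  assumes "1 \<le> n"
  shows "total_leaves (graph_power (path_graph n) 3) = leaf_total n"
proof -
  have "pair_graph \<lparr>pverts = {1..n}, parcs = cube {1..n}\<rparr>"
    using finite_cube[of "{1..n}"] by (auto simp: pair_graph_iff cube_def cube_adj_def irrefl_def sym_def)
  moreover have "{1..n} \<noteq> {}" using assms by simp
  ultimately have "total_leaves (graph_power (path_graph n) 3) =
      (\<Sum>E\<in>trees (cube {1..n}) {1..n}. card (leaves \<lparr>pverts = {1..n}, parcs = E\<rparr>))"
    unfolding total_leaves_def graph_power_path_graph
    by (subst spanning_trees_eq_trees) (simp_all add: sum.reindex inj_on_def)
  then show ?thesis
    unfolding card_leaves sum_leaves_cube leaf_total_def .
qed

theorem theorem6p2p2:
  shows "Abs_fps (\<lambda>m. of_nat (total_leaves (graph_power (path_graph (m + 5)) 3)) :: rat) =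
    2 * (16 * fps_X ^ 10 - 154 * fps_X ^ 9 + 403 * fps_X ^ 8 - 340 * fps_X ^ 7
         + 963 * fps_X ^ 6 - 768 * fps_X ^ 5 + 1109 * fps_X ^ 4 - 788 * fps_X ^ 3
         + 509 * fps_X ^ 2 - 470 * fps_X + 96)
    / ((fps_X - 1) ^ 2 * (fps_X ^ 4 - 4 * fps_X ^ 3 - fps_X ^ 2 - 4 * fps_X + 1) ^ 2)"
proof -
  have "fps_nth char_poly 0 = -1"
    by (simp add: char_poly_def fps_nth_numeral_times)
  then have nonzero: "char_poly ^ 2 \<noteq> 0" by auto
  have denominator: "(fps_X - 1) ^ 2 * (fps_X ^ 4 - 4 * fps_X ^ 3 - fps_X ^ 2 - 4 * fps_X + 1) ^ 2 = char_poly ^ 2"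
    by (simp only: char_poly_def power_mult_distrib)
  have leaves: "total_leaves (graph_power (path_graph (m + 5)) 3) = leaf_total (m + 5)" for m
    by (rule total_leaves_path_cube) simp
  show ?thesis
    unfolding leaves denominator leaf_total_generating_function[symmetric]
    by (rule nonzero_mult_div_cancel_right[OF nonzero, symmetric])
qed

end
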